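(* Let $n\in\mathbb N^+$, let $k\ge 2$ be an integer with $k\le n^{0.001}$, let $\ell\le n^{0.001}$, and let $d=cn$ for a constant $c\in(0,1/2]$. Let $\mathcal F_{n,\ell}$ be the set of maps from symmetric $n\times n$ real matrices to symmetric $n\times n$ real matrices each of whose entries is a polynomial of degree at most $\ell$ in the entries of the input. Then there is a constant $C>0$ such that for all sufficiently large $n$, $$\min_{f\in\mathcal F_{n,\ell}}\ \max_{\epsilon\in[0,1]}\ \mathbb E_{(Y,\theta^\circ)\sim\mathrm{SSBM}(n,\frac dn,\epsilon,k)}\|f(Y)-\theta^\circ\|_F^2\ \ge\ C\,k\,n,$$ where $Y$ is the adjacency matrix and $\theta^\circ$ the edge connection probability matrix of the sampled model.
   Context: $\mathrm{SSBM}(n,\frac{d}{n},\epsilon,k)$ ($n$ a multiple of $k$): each vertex gets a label $x^\circ_i\in[k]$ independently and uniformly; edges are added independently with probability $(1+\frac{k-1}{k}\epsilon)\frac dn$ if $x^\circ_i=x^\circ_j$ and $(1-\frac\epsilon k)\frac dn$ otherwise. Edge connection probability matrix: $\theta^\circ_{i,j}=(1+\frac{(k-1)\epsilon}{k})\frac dn$ if $x^\circ_i=x^\circ_j$ and $(1-\frac\epsilon k)\frac dn$ otherwise. *)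

theory Defs
  imports "HOL-Analysis.Analysis"
begin

text \<open>Matrices indexed by vertices 0..n-1 are functions nat => nat => real;
 only entries with indices < n matter.\<close>

definition sym_mat :: "nat \<Rightarrow> (nat \<Rightarrow> nat \<Rightarrow> real) \<Rightarrow> bool" where
  "sym_mat n Y \<longleftrightarrow> (\<forall>i<n. \<forall>j<n. Y i j = Y j i)"

definition deg_monos :: "nat \<Rightarrow> nat \<Rightarrow> (nat \<times> nat \<Rightarrow> nat) set" where
  "deg_monos n l = {\<alpha>. (\<forall>p. \<alpha> p \<noteq> 0 \<longrightarrow> p \<in> {..<n} \<times> {..<n})
                  \<and> (\<Sum>p\<in>{..<n} \<times> {..<n}. \<alpha> p) \<le> l}"

definition monomial_eval :: "nat \<Rightarrow> (nat \<times> nat \<Rightarrow> nat) \<Rightarrow> (nat \<Rightarrow> nat \<Rightarrow> real) \<Rightarrow> real" where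
  "monomial_eval n \<alpha> Y = (\<Prod>p\<in>{..<n} \<times> {..<n}. Y (fst p) (snd p) ^ \<alpha> p)"

definition poly_maps :: "nat \<Rightarrow> nat \<Rightarrow> ((nat \<Rightarrow> nat \<Rightarrow> real) \<Rightarrow> (nat \<Rightarrow> nat \<Rightarrow> real)) set" where
  "poly_maps n l = {f.
     (\<forall>Y. sym_mat n Y \<longrightarrow> sym_mat n (f Y)) \<and>
     (\<forall>i<n. \<forall>j<n. \<exists>c :: (nat \<times> nat \<Rightarrow> nat) \<Rightarrow> real.
        \<forall>Y. sym_mat n Y \<longrightarrow> f Y i j = (\<Sum>\<alpha>\<in>deg_monos n l. c \<alpha> * monomial_eval n \<alpha> Y))}"

text \<open>Possible edges of a simple graph on {0..n-1}: pairs (i,j) with i<j<n.\<close>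
definition pairs :: "nat \<Rightarrow> (nat \<times> nat) set" where
  "pairs n = {(i,j). i < j \<and> j < n}"

definition adj :: "(nat \<times> nat) set \<Rightarrow> nat \<Rightarrow> nat \<Rightarrow> real" where
  "adj E i j = (if (i,j) \<in> E \<or> (j,i) \<in> E then 1 else 0)"

text \<open>Edge connection probability matrix theta for labels x (q = d/n).\<close>
definition ssbm_theta :: "real \<Rightarrow> real \<Rightarrow> nat \<Rightarrow> (nat \<Rightarrow> nat) \<Rightarrow> nat \<Rightarrow> nat \<Rightarrow> real" where
  "ssbm_theta q \<epsilon> k x i j =
     (if x i = x j then (1 + real (k - 1) * \<epsilon> / real k) * q else (1 - \<epsilon> / real k) * q)"

definition graph_prob :: "nat \<Rightarrow> real \<Rightarrow> real \<Rightarrow> nat \<Rightarrow> (nat \<Rightarrow> nat) \<Rightarrow> (nat \<times> nat) set \<Rightarrow> real" where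
  "graph_prob n q \<epsilon> k x E =
     (\<Prod>e\<in>pairs n. if e \<in> E then ssbm_theta q \<epsilon> k x (fst e) (snd e)
                     else 1 - ssbm_theta q \<epsilon> k x (fst e) (snd e))"

definition frob_sq :: "nat \<Rightarrow> (nat \<Rightarrow> nat \<Rightarrow> real) \<Rightarrow> real" where
  "frob_sq n A = (\<Sum>i<n. \<Sum>j<n. (A i j)\<^sup>2)"

definition ssbm_risk :: "nat \<Rightarrow> real \<Rightarrow> real \<Rightarrow> nat \<Rightarrow>
      ((nat \<Rightarrow> nat \<Rightarrow> real) \<Rightarrow> (nat \<Rightarrow> nat \<Rightarrow> real)) \<Rightarrow> real" where
  "ssbm_risk n q \<epsilon> k f =
     (\<Sum>x\<in>PiE {..<n} (\<lambda>_. {..<k}). (1 / real k ^ n) *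
        (\<Sum>E\<in>Pow (pairs n). graph_prob n q \<epsilon> k x E *
           frob_sq n (\<lambda>i j. f (adj E) i j - ssbm_theta q \<epsilon> k x i j)))"

end

theory Submission
  imports Defs "HOL-Real_Asymp.Real_Asymp"
begin

text \<open>
  Write \<open>M\<^sub>e = 1[x\<^sub>i = x\<^sub>j] - 1/k\<close> for \<open>e = (i, j)\<close>, so that \<open>\<theta>\<^sub>e = q (1 + \<epsilon> M\<^sub>e)\<close>, and take \<open>\<epsilon>\<close> a
  small constant multiple of \<open>k / sqrt (c n)\<close>, just below the Kesten--Stigum threshold. For a fixed
  pair \<open>a = (u, v)\<close> define \<open>\<kappa>\<close> on edge sets by \<open>\<Sum>T\<subseteq>S. \<kappa>\<^sub>T E[M\<^sup>S\<^sup>-\<^sup>T] = E[M\<^sub>a M\<^sup>S]\<close> (the cumulants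
  of Schramm and Wein). The function \<open>h = \<Sum>T. (q\<epsilon>)\<^sup>|\<^sup>T\<^sup>| \<kappa>\<^sub>T \<Prod>e\<in>T. (Y\<^sub>e - \<theta>\<^sub>e) / (\<theta>\<^sub>e (1 - \<theta>\<^sub>e))\<close>,
  with \<open>T\<close> ranging over the edge sets of size at most \<open>\<ell>\<close>, has the same correlation as \<open>M\<^sub>a\<close> with
  every polynomial of degree at most \<open>\<ell>\<close> in \<open>Y\<close>; hence no such polynomial estimates \<open>M\<^sub>a\<close> with
  error below \<open>E M\<^sub>a\<^sup>2 - E h\<^sup>2\<close>.

  It remains to see that \<open>E h\<^sup>2\<close> is much smaller than \<open>1/k\<close>. The cumulant \<open>\<kappa>\<^sub>S\<close> vanishes unless \<open>S\<close>
  together with the edge \<open>a\<close> is connected and every vertex other than \<open>u, v\<close> has degree at least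
  two. Such an \<open>S\<close> with \<open>p\<close> vertices besides \<open>u, v\<close> and \<open>p + j\<close> edges has at most \<open>6j\<close> edges at
  branching vertices, which gives \<open>|\<kappa>\<^sub>S| \<le> (2/k)\<^sup>p\<^sup>+\<^sup>1 (4\<ell>)\<^sup>6\<^sup>j\<close>, and there are at most
  \<open>2 (2n)\<^sup>p (2(\<ell>+2)\<^sup>2)\<^sup>j\<close> of them. The sum over \<open>p\<close> is geometric by the choice of \<open>\<epsilon>\<close>, and every one
  of the \<open>j \<ge> 1\<close> closing edges gains a factor close to \<open>1/n\<close>.
\<close>

section \<open>Uniform averages\<close>

definition mean :: "'a set \<Rightarrow> ('a \<Rightarrow> real) \<Rightarrow> real" where
  "mean A g = (\<Sum>x\<in>A. g x) / real (card A)"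

lemma mean_const: "finite A \<Longrightarrow> A \<noteq> {} \<Longrightarrow> mean A (\<lambda>_. a) = a"
  by (simp add: mean_def)

lemma mean_cmult: "mean A (\<lambda>x. a * g x) = a * mean A g"
  by (simp add: mean_def sum_distrib_left)

lemma mean_add: "mean A (\<lambda>x. g x + h x) = mean A g + mean A h"
  by (simp add: mean_def sum.distrib add_divide_distrib)

lemma mean_diff: "mean A (\<lambda>x. g x - h x) = mean A g - mean A h"
  by (simp add: mean_def sum_subtractf diff_divide_distrib)

lemma mean_sum: "mean A (\<lambda>x. \<Sum>i\<in>I. g i x) = (\<Sum>i\<in>I. mean A (g i))"
  unfolding mean_def by (subst sum.swap) (simp add: sum_divide_distrib)

lemma mean_cong: "(\<And>x. x \<in> A \<Longrightarrow> g x = h x) \<Longrightarrow> mean A g = mean A h"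
  by (simp add: mean_def)

lemma mean_mono: "(\<And>x. x \<in> A \<Longrightarrow> g x \<le> h x) \<Longrightarrow> mean A g \<le> mean A h"
  unfolding mean_def by (intro divide_right_mono sum_mono) auto

lemma mean_nonneg: "(\<And>x. x \<in> A \<Longrightarrow> 0 \<le> g x) \<Longrightarrow> 0 \<le> mean A g"
  by (simp add: mean_def sum_nonneg)

lemma abs_mean_le: "\<bar>mean A g\<bar> \<le> mean A (\<lambda>x. \<bar>g x\<bar>)"
  by (simp add: mean_def divide_right_mono)

lemma mean_PiE_insert:
  assumes "w \<notin> V" "finite V"
  shows "mean (PiE (insert w V) B) g = mean (PiE V B) (\<lambda>x. mean (B w) (\<lambda>b. g (x(w := b))))"
proof -
  have "(\<Sum>x\<in>PiE (insert w V) B. g x) = (\<Sum>(b, x)\<in>B w \<times> PiE V B. g (x(w := b)))"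
    unfolding PiE_insert_eq sum.reindex[OF inj_combinator[OF assms(1)]]
    by (simp add: case_prod_unfold)
  also have "\<dots> = (\<Sum>x\<in>PiE V B. \<Sum>b\<in>B w. g (x(w := b)))"
    unfolding sum.cartesian_product[symmetric] by (rule sum.swap)
  finally show ?thesis
    using assms by (simp add: mean_def card_PiE sum_divide_distrib mult.commute)
qed

definition resample :: "'a set \<Rightarrow> 'v \<Rightarrow> (('v \<Rightarrow> 'a) \<Rightarrow> real) \<Rightarrow> ('v \<Rightarrow> 'a) \<Rightarrow> real" where
  "resample A w g x = mean A (\<lambda>b. g (x(w := b)))"

definition depends_on :: "'v set \<Rightarrow> (('v \<Rightarrow> 'a) \<Rightarrow> 'b) \<Rightarrow> bool" where
  "depends_on W g \<longleftrightarrow> (\<forall>x y. (\<forall>i\<in>W. x i = y i) \<longrightarrow> g x = g y)"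

lemma depends_onD: "depends_on W g \<Longrightarrow> (\<And>i. i \<in> W \<Longrightarrow> x i = y i) \<Longrightarrow> g x = g y"
  unfolding depends_on_def by blast

lemma depends_on_mono: "depends_on U g \<Longrightarrow> U \<subseteq> W \<Longrightarrow> depends_on W g"
  unfolding depends_on_def by blast

lemma depends_on_const: "depends_on U (\<lambda>_. a)"
  by (simp add: depends_on_def)

lemma depends_on_mult: "depends_on U g \<Longrightarrow> depends_on U h \<Longrightarrow> depends_on U (\<lambda>x. g x * h x)"
  unfolding depends_on_def by metis

lemma depends_on_abs: "depends_on U g \<Longrightarrow> depends_on U (\<lambda>x. \<bar>g x\<bar>)"
  unfolding depends_on_def by metis

lemma depends_on_prod:
  "(\<And>e. e \<in> S \<Longrightarrow> depends_on U (g e)) \<Longrightarrow> depends_on U (\<lambda>x. \<Prod>e\<in>S. g e x)"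
  unfolding depends_on_def by (intro allI impI prod.cong refl) blast

lemma depends_on_resample:
  assumes "depends_on (insert w W) h"
  shows "depends_on W (resample A w h)"
  unfolding depends_on_def
proof (intro allI impI)
  fix x y :: "'a \<Rightarrow> 'b"
  assume "\<forall>i\<in>W. x i = y i"
  then have "h (x(w := b)) = h (y(w := b))" for b
    by (intro depends_onD[OF assms]) auto
  then show "resample A w h x = resample A w h y"
    by (simp add: resample_def)
qed

lemma resample_mult:
  assumes "depends_on (- {w}) g"
  shows "resample A w (\<lambda>x. g x * h x) x = g x * resample A w h x"
proof -
  have "g (x(w := b)) = g x" for b
    by (rule depends_onD[OF assms]) auto
  then show ?thesis
    by (simp add: resample_def mean_cmult)
qed

lemma mean_resample:
  assumes "finite V" "w \<in> V" "finite (B w)" "B w \<noteq> {}"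
  shows "mean (PiE V B) (resample (B w) w g) = mean (PiE V B) g"
proof -
  obtain U where "V = insert w U" "w \<notin> U"
    using assms(2) by (blast dest: mk_disjoint_insert)
  then show ?thesis
    using assms by (simp add: mean_PiE_insert resample_def mean_const)
qed

lemma mean_mult_resample:
  assumes "finite V" "w \<in> V" "finite (B w)" "B w \<noteq> {}" "depends_on (- {w}) g"
  shows "mean (PiE V B) (\<lambda>x. g x * h x) = mean (PiE V B) (\<lambda>x. g x * resample (B w) w h x)"
proof -
  have "mean (PiE V B) (\<lambda>x. g x * h x) = mean (PiE V B) (resample (B w) w (\<lambda>x. g x * h x))"
    using assms(1-4) by (rule mean_resample[symmetric])
  also have "\<dots> = mean (PiE V B) (\<lambda>x. g x * resample (B w) w h x)"
    by (rule mean_cong) (rule resample_mult[OF assms(5)])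
  finally show ?thesis .
qed

lemma mean_mult_indep:
  assumes "finite V" "\<And>i. i \<in> V \<Longrightarrow> finite (B i)" "\<And>i. i \<in> V \<Longrightarrow> B i \<noteq> {}"
    and "W \<subseteq> V" "depends_on (- W) g" "depends_on W h"
  shows "mean (PiE V B) (\<lambda>x. g x * h x) = mean (PiE V B) g * mean (PiE V B) h"
proof -
  have finite_PiE: "finite (PiE V B)" and nonempty_PiE: "PiE V B \<noteq> {}"
    using assms by (auto intro: FuncSet.finite_PiE simp: PiE_eq_empty_iff)
  from finite_subset[OF assms(4,1)] assms(4-6) show ?thesis
  proof (induction W arbitrary: h rule: finite_induct)
    case empty
    then have "h = (\<lambda>_. h (\<lambda>_. undefined))"
      by (intro ext) (simp add: depends_on_def)
    then obtain a where h_const: "h = (\<lambda>_. a)" ..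
    show ?case
      unfolding h_const
      by (simp add: mult.commute[of _ a] mean_cmult mean_const finite_PiE nonempty_PiE)
  next
    case (insert w W)
    have g_depends: "depends_on (- {w}) g" "depends_on (- W) g"
      by (rule depends_on_mono[OF insert.prems(2)], blast)+
    have w_label: "w \<in> V" "finite (B w)" "B w \<noteq> {}" using assms(2,3) insert.prems(1) by auto
    have "mean (PiE V B) (\<lambda>x. g x * h x) = mean (PiE V B) (\<lambda>x. g x * resample (B w) w h x)"
      using assms(1) w_label g_depends(1) by (rule mean_mult_resample)
    also have "\<dots> = mean (PiE V B) g * mean (PiE V B) (resample (B w) w h)"
      using insert.prems by (intro insert.IH depends_on_resample g_depends) auto
    finally show ?case
      by (simp add: mean_resample assms(1) w_label)
  qed
qed

section \<open>Cumulants\<close>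

context
  fixes X :: "'x set" and Y :: "'x \<Rightarrow> real" and M :: "'e \<Rightarrow> 'x \<Rightarrow> real"
begin

function cumulant :: "'e set \<Rightarrow> real" where
  "cumulant S = (if finite S
     then mean X (\<lambda>x. Y x * (\<Prod>e\<in>S. M e x)) - (\<Sum>T | T \<subset> S. cumulant T * mean X (\<lambda>x. \<Prod>e\<in>S - T. M e x))
     else 0)"
  by auto
termination
  by (relation "Wellfounded.measure card") (auto intro: psubset_card_mono)

declare cumulant.simps[simp del]

lemma cumulant_eq:
  assumes "finite S"
  shows "cumulant S = mean X (\<lambda>x. Y x * (\<Prod>e\<in>S. M e x))
    - (\<Sum>T | T \<subset> S. cumulant T * mean X (\<lambda>x. \<Prod>e\<in>S - T. M e x))"
  using cumulant.simps[of S] assms by simp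

lemma sum_cumulant_Pow:
  assumes "finite X" "X \<noteq> {}" "finite S"
  shows "(\<Sum>T\<in>Pow S. cumulant T * mean X (\<lambda>x. \<Prod>e\<in>S - T. M e x)) = mean X (\<lambda>x. Y x * (\<Prod>e\<in>S. M e x))"
proof -
  have "Pow S = insert S {T. T \<subset> S}" by auto
  moreover have "finite {T. T \<subset> S}" using assms(3) by (auto intro: finite_subset[of _ "Pow S"])
  ultimately show ?thesis
    using cumulant_eq[OF assms(3)] by (simp add: mean_const assms)
qed

lemma cumulant_eq_0_if_moments_eq_0:
  assumes "finite S" "e \<in> S"
    and "\<And>T. T \<subseteq> S \<Longrightarrow> e \<in> T \<Longrightarrow> mean X (\<lambda>x. Y x * (\<Prod>e\<in>T. M e x)) = 0"
    and "\<And>T. T \<subseteq> S \<Longrightarrow> e \<in> T \<Longrightarrow> mean X (\<lambda>x. \<Prod>e\<in>T. M e x) = 0"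
  shows "cumulant S = 0"
  using assms
proof (induction S rule: finite_psubset_induct)
  case (psubset S)
  have "cumulant T * mean X (\<lambda>x. \<Prod>e\<in>S - T. M e x) = 0" if "T \<subset> S" for T
  proof (cases "e \<in> T")
    case True
    then have "cumulant T = 0" using that psubset.prems by (intro psubset.IH) auto
    then show ?thesis by simp
  next
    case False
    then show ?thesis using psubset.prems by simp
  qed
  then have "(\<Sum>T | T \<subset> S. cumulant T * mean X (\<lambda>x. \<Prod>e\<in>S - T. M e x)) = 0"
    by (intro sum.neutral) blast
  then show ?case
    using psubset.prems cumulant_eq[OF psubset.hyps] by simp
qed

lemma cumulant_eq_0_if_indep:
  assumes "finite X" "X \<noteq> {}" "finite (A \<union> B)" "A \<inter> B = {}" "B \<noteq> {}"
    and "\<And>C D. C \<subseteq> A \<Longrightarrow> D \<subseteq> B \<Longrightarrow> mean X (\<lambda>x. Y x * (\<Prod>e\<in>C. M e x) * (\<Prod>e\<in>D. M e x))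
      = mean X (\<lambda>x. Y x * (\<Prod>e\<in>C. M e x)) * mean X (\<lambda>x. \<Prod>e\<in>D. M e x)"
    and "\<And>C D. C \<subseteq> A \<Longrightarrow> D \<subseteq> B \<Longrightarrow> mean X (\<lambda>x. (\<Prod>e\<in>C. M e x) * (\<Prod>e\<in>D. M e x))
      = mean X (\<lambda>x. \<Prod>e\<in>C. M e x) * mean X (\<lambda>x. \<Prod>e\<in>D. M e x)"
  shows "cumulant (A \<union> B) = 0"
  using assms(3-)
proof (induction "card (A \<union> B)" arbitrary: A B rule: less_induct)
  case (less A B)
  let ?m = "\<lambda>S. mean X (\<lambda>x. \<Prod>e\<in>S. M e x)"
  have prod_Un: "(\<Prod>e\<in>C \<union> B. M e x) = (\<Prod>e\<in>C. M e x) * (\<Prod>e\<in>B. M e x)" if "C \<subseteq> A" for C x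
    using less.prems(1,2) that by (intro prod.union_disjoint) (auto intro: finite_subset)
  have crossing: "cumulant T = 0" if "T \<subset> A \<union> B" "\<not> T \<subseteq> A" for T
  proof -
    have split_T: "(T \<inter> A) \<union> (T \<inter> B) = T" using that by auto
    have "cumulant ((T \<inter> A) \<union> (T \<inter> B)) = 0"
    proof (rule less.hyps)
      show "card (T \<inter> A \<union> T \<inter> B) < card (A \<union> B)"
        using psubset_card_mono[OF less.prems(1) that(1)] by (simp add: split_T)
    qed (use less.prems that split_T in \<open>auto intro: finite_subset\<close>)
    then show ?thesis by (simp add: split_T)
  qed
  have "(\<Sum>T | T \<subset> A \<union> B. cumulant T * ?m (A \<union> B - T)) = (\<Sum>T\<in>Pow A. cumulant T * ?m (A \<union> B - T))"
  proof (rule sum.mono_neutral_right)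
    show "finite {T. T \<subset> A \<union> B}"
      using less.prems(1) by (auto intro: finite_subset[of _ "Pow (A \<union> B)"])
    show "Pow A \<subseteq> {T. T \<subset> A \<union> B}" using less.prems by auto
  qed (use crossing in auto)
  also have "\<dots> = (\<Sum>T\<in>Pow A. cumulant T * ?m (A - T)) * ?m B"
    unfolding sum_distrib_right
  proof (rule sum.cong[OF refl])
    fix T assume "T \<in> Pow A"
    then have "A \<union> B - T = (A - T) \<union> B" using less.prems by auto
    then show "cumulant T * ?m (A \<union> B - T) = cumulant T * ?m (A - T) * ?m B"
      using less.prems(5)[of "A - T" B] by (simp add: prod_Un)
  qed
  also have "\<dots> = mean X (\<lambda>x. Y x * (\<Prod>e\<in>A. M e x)) * ?m B"
    using less.prems(1) assms(1,2) by (simp add: sum_cumulant_Pow)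
  also have "\<dots> = mean X (\<lambda>x. Y x * (\<Prod>e\<in>A \<union> B. M e x))"
    using less.prems(4)[of A B] by (simp add: prod_Un mult.assoc)
  finally show ?case
    by (simp add: cumulant_eq[OF less.prems(1)])
qed

end

section \<open>Independent Bernoulli coordinates\<close>

definition coin_mean :: "real \<Rightarrow> (bool \<Rightarrow> real) \<Rightarrow> real" where
  "coin_mean p \<phi> = p * \<phi> True + (1 - p) * \<phi> False"

definition bernoulli_weight :: "'e set \<Rightarrow> ('e \<Rightarrow> real) \<Rightarrow> 'e set \<Rightarrow> real" where
  "bernoulli_weight P t E = (\<Prod>e\<in>P. if e \<in> E then t e else 1 - t e)"

definition bernoulli_mean :: "'e set \<Rightarrow> ('e \<Rightarrow> real) \<Rightarrow> ('e set \<Rightarrow> real) \<Rightarrow> real" where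
  "bernoulli_mean P t g = (\<Sum>E\<in>Pow P. bernoulli_weight P t E * g E)"

lemma bernoulli_mean_add:
  "bernoulli_mean P t (\<lambda>E. g E + h E) = bernoulli_mean P t g + bernoulli_mean P t h"
  by (simp add: bernoulli_mean_def distrib_left sum.distrib)

lemma bernoulli_mean_diff:
  "bernoulli_mean P t (\<lambda>E. g E - h E) = bernoulli_mean P t g - bernoulli_mean P t h"
  by (simp add: bernoulli_mean_def right_diff_distrib sum_subtractf)

lemma bernoulli_mean_cmult: "bernoulli_mean P t (\<lambda>E. a * g E) = a * bernoulli_mean P t g"
  by (simp add: bernoulli_mean_def sum_distrib_left mult.left_commute)

lemma bernoulli_mean_sum:
  "bernoulli_mean P t (\<lambda>E. \<Sum>i\<in>I. g i E) = (\<Sum>i\<in>I. bernoulli_mean P t (g i))"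
  unfolding bernoulli_mean_def sum_distrib_left by (rule sum.swap)

lemma bernoulli_mean_cong:
  "(\<And>E. E \<subseteq> P \<Longrightarrow> g E = h E) \<Longrightarrow> bernoulli_mean P t g = bernoulli_mean P t h"
  by (simp add: bernoulli_mean_def)

lemma bernoulli_mean_nonneg:
  assumes "\<And>e. e \<in> P \<Longrightarrow> 0 \<le> t e \<and> t e \<le> 1" "\<And>E. E \<subseteq> P \<Longrightarrow> 0 \<le> g E"
  shows "0 \<le> bernoulli_mean P t g"
  unfolding bernoulli_mean_def bernoulli_weight_def
  using assms by (intro sum_nonneg mult_nonneg_nonneg prod_nonneg) auto

lemma bernoulli_mean_prod:
  assumes "finite P"
  shows "bernoulli_mean P t (\<lambda>E. \<Prod>e\<in>P. \<phi> e (e \<in> E)) = (\<Prod>e\<in>P. coin_mean (t e) (\<phi> e))"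
proof -
  have "bernoulli_weight P t E * (\<Prod>e\<in>P. \<phi> e (e \<in> E))
      = (\<Prod>e\<in>E. t e * \<phi> e True) * (\<Prod>e\<in>P - E. (1 - t e) * \<phi> e False)" if "E \<in> Pow P" for E
  proof -
    have "bernoulli_weight P t E * (\<Prod>e\<in>P. \<phi> e (e \<in> E))
        = (\<Prod>e\<in>P. if e \<in> E then t e * \<phi> e True else (1 - t e) * \<phi> e False)"
      unfolding bernoulli_weight_def prod.distrib[symmetric] by (rule prod.cong) auto
    moreover have "P \<inter> {e. e \<in> E} = E" "P \<inter> - {e. e \<in> E} = P - E" using that by auto
    ultimately show ?thesis
      using assms by (simp add: prod.If_cases)
  qed
  then show ?thesis
    unfolding bernoulli_mean_def coin_mean_def by (simp add: prod_add[OF assms])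
qed

lemma bernoulli_mean_prod_mult_prod:
  assumes "finite P" "S \<subseteq> P" "T \<subseteq> P"
  shows "bernoulli_mean P t (\<lambda>E. (\<Prod>e\<in>S. a e (e \<in> E)) * (\<Prod>e\<in>T. b e (e \<in> E)))
    = (\<Prod>e\<in>S \<inter> T. coin_mean (t e) (\<lambda>c. a e c * b e c))
      * (\<Prod>e\<in>S - T. coin_mean (t e) (a e)) * (\<Prod>e\<in>T - S. coin_mean (t e) (b e))"
proof -
  have extend: "(\<Prod>e\<in>S. f e) = (\<Prod>e\<in>P. if e \<in> S then f e else 1)" if "S \<subseteq> P" for S
    and f :: "'a \<Rightarrow> real"
    using prod.inter_restrict[OF assms(1), of f S] that by (simp add: Int_absorb1)
  define \<phi> where "\<phi> e c = (if e \<in> S then a e c else 1) * (if e \<in> T then b e c else 1)" for e c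
  have "(\<Prod>e\<in>S. a e (e \<in> E)) * (\<Prod>e\<in>T. b e (e \<in> E)) = (\<Prod>e\<in>P. \<phi> e (e \<in> E))" for E
    unfolding extend[OF assms(2)] extend[OF assms(3)] \<phi>_def by (rule prod.distrib[symmetric])
  then have "bernoulli_mean P t (\<lambda>E. (\<Prod>e\<in>S. a e (e \<in> E)) * (\<Prod>e\<in>T. b e (e \<in> E)))
      = (\<Prod>e\<in>P. coin_mean (t e) (\<phi> e))"
    by (simp add: bernoulli_mean_prod[OF assms(1)])
  also have "\<dots> = (\<Prod>e\<in>P. (if e \<in> S \<inter> T then coin_mean (t e) (\<lambda>c. a e c * b e c) else 1)
      * (if e \<in> S - T then coin_mean (t e) (a e) else 1)
      * (if e \<in> T - S then coin_mean (t e) (b e) else 1))"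
    by (rule prod.cong) (auto simp: \<phi>_def coin_mean_def)
  also have "\<dots> = (\<Prod>e\<in>S \<inter> T. coin_mean (t e) (\<lambda>c. a e c * b e c))
      * (\<Prod>e\<in>S - T. coin_mean (t e) (a e)) * (\<Prod>e\<in>T - S. coin_mean (t e) (b e))"
    using assms(2,3) by (subst (1 2 3) extend) (auto simp: prod.distrib)
  finally show ?thesis .
qed

definition dual_factor :: "real \<Rightarrow> bool \<Rightarrow> real" where
  "dual_factor p c = (of_bool c - p) / (p * (1 - p))"

definition centred_monomial :: "real \<Rightarrow> 'e set \<Rightarrow> 'e set \<Rightarrow> real" where
  "centred_monomial q S E = (\<Prod>e\<in>S. of_bool (e \<in> E) - q)"

definition dual_monomial :: "('e \<Rightarrow> real) \<Rightarrow> 'e set \<Rightarrow> 'e set \<Rightarrow> real" where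
  "dual_monomial t T E = (\<Prod>e\<in>T. dual_factor (t e) (e \<in> E))"

lemma prod_of_bool:
  "finite A \<Longrightarrow> (\<Prod>x\<in>A. of_bool (Q x) :: 'b::comm_semiring_1) = of_bool (\<forall>x\<in>A. Q x)"
  by (induction A rule: finite_induct) auto

lemma of_bool_subset_eq_sum_centred_monomial:
  assumes "finite Q"
  shows "of_bool (Q \<subseteq> E) = (\<Sum>S\<in>Pow Q. q ^ card (Q - S) * centred_monomial q S E)"
proof -
  have "(of_bool (Q \<subseteq> E) :: real) = (\<Prod>e\<in>Q. of_bool (e \<in> E))"
    by (simp add: prod_of_bool assms subset_iff Ball_def)
  also have "\<dots> = (\<Prod>e\<in>Q. (of_bool (e \<in> E) - q) + q)" by simp
  also have "\<dots> = (\<Sum>S\<in>Pow Q. centred_monomial q S E * q ^ card (Q - S))"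
    unfolding centred_monomial_def by (subst prod_add[OF assms]) simp
  finally show ?thesis by (simp add: mult.commute)
qed

lemma coin_mean_centred: "coin_mean p (\<lambda>c. of_bool c - q) = p - q"
  by (simp add: coin_mean_def algebra_simps)

lemma
  assumes "0 < p" "p < 1"
  shows coin_mean_dual_factor: "coin_mean p (dual_factor p) = 0"
    and coin_mean_centred_dual: "coin_mean p (\<lambda>c. (of_bool c - q) * dual_factor p c) = 1"
    and coin_mean_dual_dual: "coin_mean p (\<lambda>c. dual_factor p c * dual_factor p c)
        = 1 / (p * (1 - p))"
proof -
  have nonzero: "p \<noteq> 0" "1 - p \<noteq> 0" using assms by auto
  have dual: "dual_factor p True = 1 / p" "dual_factor p False = - (1 / (1 - p))"
    using nonzero by (simp_all add: dual_factor_def)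
  show "coin_mean p (dual_factor p) = 0" "coin_mean p (\<lambda>c. (of_bool c - q) * dual_factor p c) = 1"
    using nonzero by (simp_all add: coin_mean_def dual)
  have "1 / p + 1 / (1 - p) = 1 / (p * (1 - p))" using nonzero by (simp add: field_simps)
  then show "coin_mean p (\<lambda>c. dual_factor p c * dual_factor p c) = 1 / (p * (1 - p))"
    using nonzero by (simp add: coin_mean_def dual)
qed

lemma bernoulli_mean_centred_dual:
  assumes "finite P" "S \<subseteq> P" "T \<subseteq> P" "\<And>e. e \<in> P \<Longrightarrow> 0 < t e \<and> t e < 1"
  shows "bernoulli_mean P t (\<lambda>E. centred_monomial q S E * dual_monomial t T E)
    = (if T \<subseteq> S then \<Prod>e\<in>S - T. t e - q else 0)"
proof -
  have "bernoulli_mean P t (\<lambda>E. centred_monomial q S E * dual_monomial t T E)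
      = (\<Prod>e\<in>S \<inter> T. 1) * (\<Prod>e\<in>S - T. t e - q) * (\<Prod>e\<in>T - S. 0)"
    unfolding centred_monomial_def dual_monomial_def
      bernoulli_mean_prod_mult_prod[OF assms(1-3),
        of t "\<lambda>_ c. of_bool c - q" "\<lambda>e. dual_factor (t e)"]
    using assms(2-4) by (intro arg_cong2[where f = "(*)"] prod.cong refl)
      (auto simp: coin_mean_centred coin_mean_centred_dual coin_mean_dual_factor subset_iff)
  moreover have "(\<Prod>e\<in>T - S. 0 :: real) = of_bool (T \<subseteq> S)"
    using finite_subset[OF assms(3,1)]
    by (cases "T \<subseteq> S") (auto simp del: prod_constant intro!: prod.neutral)
  ultimately show ?thesis by simp
qed

lemma bernoulli_mean_dual_dual:
  assumes "finite P" "S \<subseteq> P" "T \<subseteq> P" "\<And>e. e \<in> P \<Longrightarrow> 0 < t e \<and> t e < 1"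
  shows "bernoulli_mean P t (\<lambda>E. dual_monomial t S E * dual_monomial t T E)
    = (if S = T then \<Prod>e\<in>S. 1 / (t e * (1 - t e)) else 0)"
proof -
  have "bernoulli_mean P t (\<lambda>E. dual_monomial t S E * dual_monomial t T E)
      = (\<Prod>e\<in>S \<inter> T. 1 / (t e * (1 - t e))) * (\<Prod>e\<in>S - T. 0) * (\<Prod>e\<in>T - S. 0)"
    unfolding dual_monomial_def
      bernoulli_mean_prod_mult_prod[OF assms(1-3),
        of t "\<lambda>e. dual_factor (t e)" "\<lambda>e. dual_factor (t e)"]
    using assms(2-4) by (intro arg_cong2[where f = "(*)"] prod.cong refl)
      (auto simp: coin_mean_dual_dual coin_mean_dual_factor subset_iff)
  moreover have "(\<Prod>e\<in>S - T. 0) * (\<Prod>e\<in>T - S. 0) = (of_bool (S = T) :: real)"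
    using finite_subset[OF assms(2,1)] finite_subset[OF assms(3,1)] by (auto simp: card_eq_0_iff)
  ultimately show ?thesis by (auto simp: mult.assoc)
qed

lemma bernoulli_mean_sum_dual_sq:
  assumes "finite P" "A \<subseteq> Pow P" "\<And>e. e \<in> P \<Longrightarrow> 0 < t e \<and> t e < 1"
  shows "bernoulli_mean P t (\<lambda>E. (\<Sum>T\<in>A. a T * dual_monomial t T E)\<^sup>2)
    = (\<Sum>T\<in>A. (a T)\<^sup>2 * (\<Prod>e\<in>T. 1 / (t e * (1 - t e))))"
proof -
  have "(\<Sum>T\<in>A. a T * dual_monomial t T E)\<^sup>2
      = (\<Sum>S\<in>A. \<Sum>T\<in>A. (a S * a T) * (dual_monomial t S E * dual_monomial t T E))" for E
    unfolding power2_eq_square sum_product by (simp only: mult_ac)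
  then have "bernoulli_mean P t (\<lambda>E. (\<Sum>T\<in>A. a T * dual_monomial t T E)\<^sup>2)
      = (\<Sum>S\<in>A. \<Sum>T\<in>A. (a S * a T)
        * bernoulli_mean P t (\<lambda>E. dual_monomial t S E * dual_monomial t T E))"
    by (simp only: bernoulli_mean_sum bernoulli_mean_cmult)
  also have "\<dots> = (\<Sum>S\<in>A. \<Sum>T\<in>A. if S = T then (a T)\<^sup>2 * (\<Prod>e\<in>T. 1 / (t e * (1 - t e))) else 0)"
  proof (intro sum.cong refl)
    fix S T assume "S \<in> A" "T \<in> A"
    then have "S \<subseteq> P" "T \<subseteq> P" using assms(2) by auto
    then show "(a S * a T) * bernoulli_mean P t (\<lambda>E. dual_monomial t S E * dual_monomial t T E)
        = (if S = T then (a T)\<^sup>2 * (\<Prod>e\<in>T. 1 / (t e * (1 - t e))) else 0)"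
      using bernoulli_mean_dual_dual[OF assms(1) _ _ assms(3), of S T]
      by (simp add: power2_eq_square)
  qed
  also have "\<dots> = (\<Sum>T\<in>A. (a T)\<^sup>2 * (\<Prod>e\<in>T. 1 / (t e * (1 - t e))))"
    using finite_subset[OF assms(2)] assms(1) by simp
  finally show ?thesis .
qed

section \<open>The low-degree lower bound\<close>

definition subsets_upto :: "'e set \<Rightarrow> nat \<Rightarrow> 'e set set" where
  "subsets_upto P l = {S. S \<subseteq> P \<and> card S \<le> l}"

text \<open>Indicators are idempotent, so every monomial of degree at most \<open>l\<close> in them is the indicator of
  \<open>Q \<subseteq> E\<close> for a set \<open>Q\<close> of at most \<open>l\<close> coordinates.\<close>

definition low_degree :: "'e set \<Rightarrow> nat \<Rightarrow> ('e set \<Rightarrow> real) set" where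
  "low_degree P l = {F. \<exists>c. \<forall>E\<subseteq>P. F E = (\<Sum>Q\<in>subsets_upto P l. c Q * of_bool (Q \<subseteq> E))}"

lemma finite_subsets_upto: "finite P \<Longrightarrow> finite (subsets_upto P l)"
  by (auto simp: subsets_upto_def intro: finite_subset[of _ "Pow P"])

lemma subsets_upto_subset:
  assumes "finite P" "S \<in> subsets_upto P l" "T \<subseteq> S"
  shows "T \<in> subsets_upto P l"
  using assms card_mono[of S T] finite_subset[of S P] by (auto simp: subsets_upto_def)

lemma low_degree_cong:
  "F \<in> low_degree P l \<Longrightarrow> (\<And>E. E \<subseteq> P \<Longrightarrow> F E = G E) \<Longrightarrow> G \<in> low_degree P l"
  by (simp add: low_degree_def)

lemma low_degree_monomial:
  assumes "finite P" "card Q \<le> l"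
  shows "(\<lambda>E. of_bool (Q \<subseteq> E)) \<in> low_degree P l"
proof -
  have "(of_bool (Q \<subseteq> E) :: real) = (\<Sum>S\<in>subsets_upto P l. of_bool (S = Q) * of_bool (S \<subseteq> E))"
    if "E \<subseteq> P" for E
  proof -
    have "(\<Sum>S\<in>subsets_upto P l. of_bool (S = Q) * of_bool (S \<subseteq> E) :: real)
        = (\<Sum>S\<in>subsets_upto P l. if S = Q then of_bool (Q \<subseteq> E) else 0)"
      by (rule sum.cong) auto
    also have "\<dots> = of_bool (Q \<subseteq> E)"
      using that assms by (auto simp: finite_subsets_upto) (auto simp: subsets_upto_def)
    finally show ?thesis ..
  qed
  then show ?thesis
    unfolding low_degree_def by (intro CollectI exI[of _ "\<lambda>S. of_bool (S = Q)"]) simp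
qed

lemma low_degree_lincomb:
  assumes "\<And>i. i \<in> I \<Longrightarrow> F i \<in> low_degree P l"
  shows "(\<lambda>E. \<Sum>i\<in>I. a i * F i E) \<in> low_degree P l"
proof -
  have "\<exists>c. \<forall>i\<in>I. \<forall>E\<subseteq>P. F i E = (\<Sum>Q\<in>subsets_upto P l. c i Q * of_bool (Q \<subseteq> E))"
    using assms unfolding low_degree_def by (intro bchoice) blast
  then obtain c where F_eq: "\<And>i E. i \<in> I \<Longrightarrow> E \<subseteq> P
      \<Longrightarrow> F i E = (\<Sum>Q\<in>subsets_upto P l. c i Q * of_bool (Q \<subseteq> E))"
    by blast
  have "(\<Sum>i\<in>I. a i * F i E) = (\<Sum>Q\<in>subsets_upto P l. (\<Sum>i\<in>I. a i * c i Q) * of_bool (Q \<subseteq> E))"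
    if "E \<subseteq> P" for E
    using that by (simp add: F_eq sum_distrib_left sum_distrib_right mult.assoc) (rule sum.swap)
  then show ?thesis
    unfolding low_degree_def by (intro CollectI exI[of _ "\<lambda>Q. \<Sum>i\<in>I. a i * c i Q"]) simp
qed

locale latent_bernoulli =
  fixes X :: "'x set" and P :: "'e set" and M :: "'e \<Rightarrow> 'x \<Rightarrow> real" and q s \<tau> :: real
  assumes finite_latent: "finite X" and latent_nonempty: "X \<noteq> {}" and finite_coords: "finite P"
    and variance_bound_pos: "0 < \<tau>"
    and variance_ge: "x \<in> X \<Longrightarrow> e \<in> P \<Longrightarrow> \<tau> \<le> (q + s * M e x) * (1 - (q + s * M e x))"
begin

definition prob :: "'x \<Rightarrow> 'e \<Rightarrow> real" where
  "prob x e = q + s * M e x"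

definition joint_mean :: "('x \<Rightarrow> 'e set \<Rightarrow> real) \<Rightarrow> real" where
  "joint_mean G = mean X (\<lambda>x. bernoulli_mean P (prob x) (G x))"

definition certificate :: "('x \<Rightarrow> real) \<Rightarrow> nat \<Rightarrow> 'x \<Rightarrow> 'e set \<Rightarrow> real" where
  "certificate Y l x E =
    (\<Sum>T\<in>subsets_upto P l. s ^ card T * cumulant X Y M T * dual_monomial (prob x) T E)"

lemma prob_bounds:
  assumes "x \<in> X" "e \<in> P"
  shows "0 < prob x e \<and> prob x e < 1"
proof -
  have "0 < prob x e * (1 - prob x e)"
    using variance_ge[OF assms] variance_bound_pos by (simp add: prob_def)
  then show ?thesis by (auto simp: zero_less_mult_iff)
qed

lemma joint_mean_add: "joint_mean (\<lambda>x E. F x E + G x E) = joint_mean F + joint_mean G"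
  by (simp add: joint_mean_def bernoulli_mean_add mean_add)

lemma joint_mean_diff: "joint_mean (\<lambda>x E. F x E - G x E) = joint_mean F - joint_mean G"
  by (simp add: joint_mean_def bernoulli_mean_diff mean_diff)

lemma joint_mean_cmult: "joint_mean (\<lambda>x E. a * G x E) = a * joint_mean G"
  by (simp add: joint_mean_def bernoulli_mean_cmult mean_cmult)

lemma joint_mean_sum: "joint_mean (\<lambda>x E. \<Sum>i\<in>I. G i x E) = (\<Sum>i\<in>I. joint_mean (G i))"
  by (simp add: joint_mean_def bernoulli_mean_sum mean_sum)

lemma joint_mean_cong:
  "(\<And>x E. x \<in> X \<Longrightarrow> E \<subseteq> P \<Longrightarrow> F x E = G x E) \<Longrightarrow> joint_mean F = joint_mean G"
  unfolding joint_mean_def by (intro mean_cong bernoulli_mean_cong)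

lemma joint_mean_nonneg: "(\<And>x E. 0 \<le> G x E) \<Longrightarrow> 0 \<le> joint_mean G"
  unfolding joint_mean_def
  by (intro mean_nonneg bernoulli_mean_nonneg) (auto intro: less_imp_le dest: prob_bounds)

lemma bernoulli_mean_centred_dual_prob:
  assumes "x \<in> X" "S \<subseteq> P" "T \<subseteq> P"
  shows "bernoulli_mean P (prob x) (\<lambda>E. centred_monomial q S E * dual_monomial (prob x) T E)
    = (if T \<subseteq> S then s ^ card (S - T) * (\<Prod>e\<in>S - T. M e x) else 0)"
  using bernoulli_mean_centred_dual[OF finite_coords assms(2,3), of "prob x" q]
    prob_bounds[OF assms(1)]
  by (simp add: prob_def prod.distrib)

lemma joint_mean_centred_target:
  assumes "S \<subseteq> P"
  shows "joint_mean (\<lambda>x E. centred_monomial q S E * Y x)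
      = s ^ card S * mean X (\<lambda>x. Y x * (\<Prod>e\<in>S. M e x))"
proof -
  have "bernoulli_mean P (prob x) (\<lambda>E. centred_monomial q S E * Y x)
      = s ^ card S * (Y x * (\<Prod>e\<in>S. M e x))"
    if "x \<in> X" for x
    using bernoulli_mean_centred_dual_prob[OF that assms, of "{}"]
    by (simp add: dual_monomial_def mult.commute[of _ "Y x"] bernoulli_mean_cmult)
  then show ?thesis
    unfolding joint_mean_def mean_cmult[symmetric] by (rule mean_cong)
qed

lemma bernoulli_mean_centred_certificate:
  assumes "x \<in> X" "S \<in> subsets_upto P l"
  shows "bernoulli_mean P (prob x) (\<lambda>E. centred_monomial q S E * certificate Y l x E)
    = s ^ card S * (\<Sum>T\<in>Pow S. cumulant X Y M T * (\<Prod>e\<in>S - T. M e x))"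
proof -
  let ?\<kappa> = "cumulant X Y M"
  have S_subset: "S \<subseteq> P" using assms(2) by (simp add: subsets_upto_def)
  then have finite_S: "finite S" using finite_coords by (rule finite_subset)
  have "bernoulli_mean P (prob x) (\<lambda>E. centred_monomial q S E * certificate Y l x E)
      = (\<Sum>T\<in>subsets_upto P l. s ^ card T * ?\<kappa> T
        * bernoulli_mean P (prob x) (\<lambda>E. centred_monomial q S E * dual_monomial (prob x) T E))"
    by (simp only: certificate_def sum_distrib_left mult.left_commute[of "centred_monomial q S _"]
        bernoulli_mean_sum bernoulli_mean_cmult)
  also have "\<dots> = (\<Sum>T\<in>subsets_upto P l. s ^ card T * ?\<kappa> T
      * (if T \<subseteq> S then s ^ card (S - T) * (\<Prod>e\<in>S - T. M e x) else 0))"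
    using S_subset assms(1)
    by (intro sum.cong refl) (simp add: subsets_upto_def bernoulli_mean_centred_dual_prob)
  also have "\<dots> = (\<Sum>T\<in>Pow S. s ^ card T * ?\<kappa> T * (s ^ card (S - T) * (\<Prod>e\<in>S - T. M e x)))"
    using subsets_upto_subset[OF finite_coords assms(2)]
    by (intro sum.mono_neutral_cong_right finite_subsets_upto finite_coords) auto
  also have "\<dots> = (\<Sum>T\<in>Pow S. s ^ card S * (?\<kappa> T * (\<Prod>e\<in>S - T. M e x)))"
  proof (rule sum.cong[OF refl])
    fix T assume "T \<in> Pow S"
    then have "card S = card T + card (S - T)"
      using finite_S by (simp add: card_Diff_subset card_mono finite_subset)
    then show "s ^ card T * ?\<kappa> T * (s ^ card (S - T) * (\<Prod>e\<in>S - T. M e x))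
        = s ^ card S * (?\<kappa> T * (\<Prod>e\<in>S - T. M e x))"
      by (simp add: power_add)
  qed
  finally show ?thesis by (simp add: sum_distrib_left)
qed

lemma joint_mean_centred_certificate:
  assumes "S \<in> subsets_upto P l"
  shows "joint_mean (\<lambda>x E. centred_monomial q S E * certificate Y l x E)
    = joint_mean (\<lambda>x E. centred_monomial q S E * Y x)"
proof -
  have S_subset: "S \<subseteq> P" using assms by (simp add: subsets_upto_def)
  have "joint_mean (\<lambda>x E. centred_monomial q S E * certificate Y l x E)
      = mean X (\<lambda>x. s ^ card S * (\<Sum>T\<in>Pow S. cumulant X Y M T * (\<Prod>e\<in>S - T. M e x)))"
    unfolding joint_mean_def
    by (rule mean_cong) (rule bernoulli_mean_centred_certificate[OF _ assms])
  also have "\<dots> = s ^ card S * mean X (\<lambda>x. Y x * (\<Prod>e\<in>S. M e x))"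
    using finite_subset[OF S_subset finite_coords]
    by (simp add: mean_cmult mean_sum sum_cumulant_Pow finite_latent latent_nonempty)
  finally show ?thesis by (simp add: joint_mean_centred_target[OF S_subset])
qed

lemma low_degree_orthogonal:
  assumes "F \<in> low_degree P l"
  shows "joint_mean (\<lambda>x E. F E * (certificate Y l x E - Y x)) = 0"
proof -
  let ?W = "\<lambda>x E. certificate Y l x E - Y x"
  have monomial: "joint_mean (\<lambda>x E. of_bool (Q \<subseteq> E) * ?W x E) = 0"
    if Q_small: "Q \<in> subsets_upto P l" for Q
  proof -
    have "finite Q"
      using Q_small finite_coords by (auto simp: subsets_upto_def intro: finite_subset)
    then have "joint_mean (\<lambda>x E. of_bool (Q \<subseteq> E) * ?W x E)
        = (\<Sum>S\<in>Pow Q. q ^ card (Q - S) * joint_mean (\<lambda>x E. centred_monomial q S E * ?W x E))"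
      by (simp only: of_bool_subset_eq_sum_centred_monomial[of _ _ q] sum_distrib_right mult.assoc
          joint_mean_sum joint_mean_cmult)
    also have "\<dots> = 0"
      using subsets_upto_subset[OF finite_coords Q_small]
      by (simp add: right_diff_distrib joint_mean_diff joint_mean_centred_certificate)
    finally show ?thesis .
  qed
  obtain c where F_eq: "\<And>E. E \<subseteq> P \<Longrightarrow> F E = (\<Sum>Q\<in>subsets_upto P l. c Q * of_bool (Q \<subseteq> E))"
    using assms unfolding low_degree_def by blast
  have "joint_mean (\<lambda>x E. F E * ?W x E)
      = joint_mean (\<lambda>x E. \<Sum>Q\<in>subsets_upto P l. c Q * (of_bool (Q \<subseteq> E) * ?W x E))"
    by (rule joint_mean_cong) (simp only: F_eq sum_distrib_right mult.assoc)
  also have "\<dots> = 0"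
    by (simp add: joint_mean_sum joint_mean_cmult monomial)
  finally show ?thesis .
qed

lemma joint_mean_certificate_sq_le:
  "joint_mean (\<lambda>x E. (certificate Y l x E)\<^sup>2)
    \<le> (\<Sum>T\<in>subsets_upto P l. (s\<^sup>2 / \<tau>) ^ card T * (cumulant X Y M T)\<^sup>2)"
proof -
  let ?\<kappa> = "cumulant X Y M"
  have "bernoulli_mean P (prob x) (\<lambda>E. (certificate Y l x E)\<^sup>2)
      \<le> (\<Sum>T\<in>subsets_upto P l. (s\<^sup>2 / \<tau>) ^ card T * (?\<kappa> T)\<^sup>2)" if latent: "x \<in> X" for x
  proof -
    have "bernoulli_mean P (prob x) (\<lambda>E. (certificate Y l x E)\<^sup>2)
        = (\<Sum>T\<in>subsets_upto P l. (s ^ card T * ?\<kappa> T)\<^sup>2 * (\<Prod>e\<in>T. 1 / (prob x e * (1 - prob x e))))"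
      unfolding certificate_def using prob_bounds[OF latent]
      by (intro bernoulli_mean_sum_dual_sq finite_coords) (auto simp: subsets_upto_def)
    also have "\<dots> \<le> (\<Sum>T\<in>subsets_upto P l. (s ^ card T * ?\<kappa> T)\<^sup>2 * (\<Prod>e\<in>T. 1 / \<tau>))"
    proof (intro sum_mono mult_left_mono prod_mono conjI)
      fix T e assume "T \<in> subsets_upto P l" "e \<in> T"
      then have coord: "e \<in> P" by (auto simp: subsets_upto_def)
      show "0 \<le> 1 / (prob x e * (1 - prob x e))"
        using prob_bounds[OF latent coord] by simp
      show "1 / (prob x e * (1 - prob x e)) \<le> 1 / \<tau>"
        using variance_ge[OF latent coord] variance_bound_pos by (simp add: prob_def frac_le)
    qed simp
    also have "\<dots> = (\<Sum>T\<in>subsets_upto P l. (s\<^sup>2 / \<tau>) ^ card T * (?\<kappa> T)\<^sup>2)"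
      by (simp add: power_mult_distrib power_divide mult.commute flip: power_mult)
    finally show ?thesis .
  qed
  then have "joint_mean (\<lambda>x E. (certificate Y l x E)\<^sup>2)
      \<le> mean X (\<lambda>_. \<Sum>T\<in>subsets_upto P l. (s\<^sup>2 / \<tau>) ^ card T * (?\<kappa> T)\<^sup>2)"
    unfolding joint_mean_def by (rule mean_mono)
  then show ?thesis by (simp add: mean_const finite_latent latent_nonempty)
qed

lemma joint_mean_latent: "joint_mean (\<lambda>x E. g x) = mean X g"
  using joint_mean_centred_target[of "{}" g] by (simp add: centred_monomial_def)

theorem low_degree_mse_ge:
  assumes "F \<in> low_degree P l"
  shows "a\<^sup>2 * (mean X (\<lambda>x. (Y x)\<^sup>2)
      - (\<Sum>T\<in>subsets_upto P l. (s\<^sup>2 / \<tau>) ^ card T * (cumulant X Y M T)\<^sup>2))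
    \<le> joint_mean (\<lambda>x E. (F E - (b + a * Y x))\<^sup>2)"
proof -
  let ?h = "certificate Y l"
  have const: "(\<lambda>E. of_bool ({} \<subseteq> E)) \<in> low_degree P l"
    by (rule low_degree_monomial[OF finite_coords]) simp
  have "joint_mean (\<lambda>x E. (F E - b) * (?h x E - Y x))
      = joint_mean (\<lambda>x E. F E * (?h x E - Y x))
        - b * joint_mean (\<lambda>x E. of_bool ({} \<subseteq> E) * (?h x E - Y x))"
    by (simp add: left_diff_distrib joint_mean_diff joint_mean_cmult)
  then have orth: "joint_mean (\<lambda>x E. (F E - b) * (?h x E - Y x)) = 0"
    by (simp only: low_degree_orthogonal[OF assms] low_degree_orthogonal[OF const])
  have "joint_mean (\<lambda>x E. (F E - (b + a * Y x))\<^sup>2)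
      = joint_mean (\<lambda>x E. ((F E - b - a * ?h x E)\<^sup>2 + 2 * a * ((F E - b) * (?h x E - Y x)))
          + a\<^sup>2 * ((Y x)\<^sup>2 - (?h x E)\<^sup>2))"
    by (intro arg_cong[where f = joint_mean] ext) (simp add: power2_eq_square algebra_simps)
  also have "\<dots> = joint_mean (\<lambda>x E. (F E - b - a * ?h x E)\<^sup>2)
      + a\<^sup>2 * (mean X (\<lambda>x. (Y x)\<^sup>2) - joint_mean (\<lambda>x E. (?h x E)\<^sup>2))"
    by (simp add: joint_mean_add joint_mean_cmult joint_mean_diff joint_mean_latent orth)
  also have "\<dots> \<ge> a\<^sup>2 * (mean X (\<lambda>x. (Y x)\<^sup>2) - joint_mean (\<lambda>x E. (?h x E)\<^sup>2))"
    by (simp add: joint_mean_nonneg)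
  finally have "a\<^sup>2 * (mean X (\<lambda>x. (Y x)\<^sup>2) - joint_mean (\<lambda>x E. (?h x E)\<^sup>2))
      \<le> joint_mean (\<lambda>x E. (F E - (b + a * Y x))\<^sup>2)" .
  moreover have "a\<^sup>2 * (mean X (\<lambda>x. (Y x)\<^sup>2)
        - (\<Sum>T\<in>subsets_upto P l. (s\<^sup>2 / \<tau>) ^ card T * (cumulant X Y M T)\<^sup>2))
      \<le> a\<^sup>2 * (mean X (\<lambda>x. (Y x)\<^sup>2) - joint_mean (\<lambda>x E. (?h x E)\<^sup>2))"
    by (intro mult_left_mono diff_left_mono joint_mean_certificate_sq_le) simp
  ultimately show ?thesis by linarith
qed

end

section \<open>Rooted edge sets\<close>

definition ends :: "'v \<times> 'v \<Rightarrow> 'v set" where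
  "ends e = {fst e, snd e}"

definition verts :: "('v \<times> 'v) set \<Rightarrow> 'v set" where
  "verts S = (\<Union>e\<in>S. ends e)"

definition incident :: "('v \<times> 'v) set \<Rightarrow> 'v \<Rightarrow> ('v \<times> 'v) set" where
  "incident S w = {e \<in> S. w \<in> ends e}"

definition edges_on :: "'v::linorder set \<Rightarrow> ('v \<times> 'v) set" where
  "edges_on V = {(i, j). i \<in> V \<and> j \<in> V \<and> i < j}"

definition connected_to :: "'v set \<Rightarrow> ('v \<times> 'v) set \<Rightarrow> bool" where
  "connected_to R S \<longleftrightarrow> (\<forall>A. A \<subset> S \<longrightarrow> (\<exists>e\<in>S - A. ends e \<inter> (verts A \<union> R) \<noteq> {}))"

definition leafless :: "('v \<times> 'v) set \<Rightarrow> bool" where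
  "leafless S \<longleftrightarrow> (\<forall>w. card (incident S w) \<noteq> 1)"

definition rooted_core :: "'v set \<Rightarrow> ('v \<times> 'v) set \<Rightarrow> bool" where
  "rooted_core R S \<longleftrightarrow> S \<noteq> {} \<and> connected_to R S \<and> (\<forall>w\<in>verts S - R. 2 \<le> card (incident S w))"

definition branch_edges :: "'v set \<Rightarrow> ('v \<times> 'v) set \<Rightarrow> ('v \<times> 'v) set" where
  "branch_edges R S = {e \<in> S. \<exists>w\<in>ends e. w \<in> R \<or> 3 \<le> card (incident S w)}"

lemma finite_verts: "finite S \<Longrightarrow> finite (verts S)"
  by (simp add: verts_def ends_def)

lemma finite_incident: "finite S \<Longrightarrow> finite (incident S w)"
  by (simp add: incident_def)

lemma verts_empty: "verts {} = {}"
  by (simp add: verts_def)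

lemma verts_insert: "verts (insert e S) = ends e \<union> verts S"
  by (auto simp: verts_def)

lemma verts_Un: "verts (S \<union> T) = verts S \<union> verts T"
  by (auto simp: verts_def)

lemma verts_mono: "S \<subseteq> T \<Longrightarrow> verts S \<subseteq> verts T"
  by (auto simp: verts_def)

lemma finite_edges_on: "finite V \<Longrightarrow> finite (edges_on V)"
  by (rule finite_subset[of _ "V \<times> V"]) (auto simp: edges_on_def)

lemma finite_subset_edges_on: "finite V \<Longrightarrow> S \<subseteq> edges_on V \<Longrightarrow> finite S"
  using finite_edges_on finite_subset by blast

lemma verts_subset_edges_on: "S \<subseteq> edges_on V \<Longrightarrow> verts S \<subseteq> V"
  by (auto simp: verts_def ends_def edges_on_def)

lemma card_ends: "e \<in> edges_on V \<Longrightarrow> card (ends e) = 2"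
  by (auto simp: ends_def edges_on_def)

lemma ends_edges_onE:
  assumes "e \<in> edges_on V" "w \<in> ends e"
  obtains z where "ends e = {w, z}" "w \<noteq> z" "w \<in> V" "z \<in> V"
  using assms by (fastforce simp: edges_on_def ends_def)

lemma connected_toE:
  assumes "connected_to R S" "A \<subset> S"
  obtains e w where "e \<in> S" "e \<notin> A" "w \<in> ends e" "w \<in> verts A \<union> R"
  using assms unfolding connected_to_def by blast

lemma connected_to_nonemptyE:
  assumes "connected_to R S" "S \<noteq> {}"
  obtains e w where "e \<in> S" "w \<in> ends e" "w \<in> R"
proof (rule connected_toE[OF assms(1)])
  show "{} \<subset> S" using assms(2) by blast
qed (use that in \<open>auto simp: verts_empty\<close>)

lemma connected_to_Diff:
  assumes "connected_to R S" "T \<subseteq> S"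
  shows "connected_to (verts T \<union> R) (S - T)"
  unfolding connected_to_def
proof (intro allI impI)
  fix A assume "A \<subset> S - T"
  then have "A \<union> T \<subset> S" using assms(2) by blast
  then obtain e w where "e \<in> S" "e \<notin> A \<union> T" "w \<in> ends e" "w \<in> verts (A \<union> T) \<union> R"
    using assms(1) by (elim connected_toE)
  then show "\<exists>e\<in>S - T - A. ends e \<inter> (verts A \<union> (verts T \<union> R)) \<noteq> {}"
    by (auto simp: verts_Un)
qed

lemma sum_card_incident:
  assumes "finite S" "S \<subseteq> edges_on V" "verts S \<subseteq> W" "finite W"
  shows "(\<Sum>w\<in>W. card (incident S w)) = 2 * card S"
proof -
  have "(\<Sum>w\<in>W. card (incident S w)) = (\<Sum>w\<in>W. \<Sum>e\<in>S. of_bool (w \<in> ends e))"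
    using assms(1) by (simp add: incident_def Int_def)
  also have "\<dots> = (\<Sum>e\<in>S. \<Sum>w\<in>W. of_bool (w \<in> ends e))"
    by (rule sum.swap)
  also have "\<dots> = (\<Sum>e\<in>S. 2)"
  proof (rule sum.cong[OF refl])
    fix e assume edge: "e \<in> S"
    then have "W \<inter> ends e = ends e" using assms(3) unfolding verts_def by blast
    then show "(\<Sum>w\<in>W. of_bool (w \<in> ends e)) = (2 :: nat)"
      using edge assms(2,4) by (auto simp: card_ends)
  qed
  finally show ?thesis by simp
qed

lemma branch_edges_subset: "branch_edges R S \<subseteq> S"
  by (auto simp: branch_edges_def)

lemma finite_branch_edges: "finite S \<Longrightarrow> finite (branch_edges R S)"
  using branch_edges_subset by (rule finite_subset)

lemma branch_edges_mono:
  assumes "finite S" "T \<subseteq> S"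
  shows "branch_edges R T \<subseteq> branch_edges R S \<inter> T"
proof -
  have "card (incident T w) \<le> card (incident S w)" for w
    using assms by (intro card_mono finite_incident) (auto simp: incident_def)
  then show ?thesis
    using assms(2) unfolding branch_edges_def by (blast intro: order_trans)
qed

lemma branch_edges_nonempty: "rooted_core R S \<Longrightarrow> branch_edges R S \<noteq> {}"
  unfolding rooted_core_def branch_edges_def by (auto elim: connected_to_nonemptyE)

lemma card_branch_edges_le:
  assumes "rooted_core R S" "S \<subseteq> edges_on V" "finite S" "finite R"
  shows "card (branch_edges R S) + 6 * card (verts S - R) \<le> 6 * card S"
proof -
  let ?V = "verts S \<union> R"
  let ?br = "\<lambda>w. w \<in> R \<or> 3 \<le> card (incident S w)"
  have finite_V: "finite ?V" using assms(3,4) by (simp add: finite_verts)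
  have "branch_edges R S \<subseteq> (\<Union>w\<in>{w\<in>?V. ?br w}. incident S w)"
    unfolding branch_edges_def incident_def verts_def by blast
  then have "card (branch_edges R S) \<le> card (\<Union>w\<in>{w\<in>?V. ?br w}. incident S w)"
    using finite_V assms(3) by (intro card_mono) (auto simp: finite_incident)
  also have "\<dots> \<le> (\<Sum>w\<in>{w\<in>?V. ?br w}. card (incident S w))"
    using finite_V by (intro card_UN_le) auto
  also have "\<dots> = (\<Sum>w\<in>?V. if ?br w then card (incident S w) else 0)"
    using finite_V by (simp only: sum.inter_filter)
  finally have branch: "card (branch_edges R S)
      \<le> (\<Sum>w\<in>?V. if ?br w then card (incident S w) else 0)" .
  have "?V \<inter> {w. w \<notin> R} = verts S - R" by blast
  then have "6 * card (verts S - R) = (\<Sum>w\<in>?V. if w \<in> R then 0 else 6)"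
    using sum.If_cases[OF finite_V, of "\<lambda>w. w \<in> R" "\<lambda>_. 0" "\<lambda>_. 6 :: nat"] by (simp add: Compl_eq)
  with branch have "card (branch_edges R S) + 6 * card (verts S - R)
      \<le> (\<Sum>w\<in>?V. (if ?br w then card (incident S w) else 0) + (if w \<in> R then 0 else 6))"
    by (simp add: sum.distrib)
  also have "\<dots> \<le> (\<Sum>w\<in>?V. 3 * card (incident S w))"
  proof (rule sum_mono)
    fix w assume "w \<in> ?V"
    then have "w \<in> R \<or> 2 \<le> card (incident S w)"
      using assms(1) unfolding rooted_core_def by blast
    then show "(if ?br w then card (incident S w) else 0) + (if w \<in> R then 0 else 6)
        \<le> 3 * card (incident S w)"
      by auto
  qed
  also have "\<dots> = 6 * card S"
    using sum_card_incident[OF assms(3,2) _ finite_V] by (simp add: sum_distrib_left[symmetric])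
  finally show ?thesis .
qed

text \<open>Along a path of degree-two vertices a leafless subgraph contains all edges or none.\<close>

lemma leafless_Diff_eqI:
  assumes core: "rooted_core R S" "finite S" and subsets: "T \<subseteq> S" "T' \<subseteq> S"
    and leafless: "leafless (S - T)" "leafless (S - T')"
    and branch_eq: "branch_edges R S \<inter> T = branch_edges R S \<inter> T'"
  shows "T = T'"
proof -
  define A where "A = {e \<in> S. e \<in> T \<longleftrightarrow> e \<in> T'}"
  have "A = S"
  proof (rule ccontr)
    assume "A \<noteq> S"
    then have "A \<subset> S" by (auto simp: A_def)
    then obtain e w where crossing: "e \<in> S" "e \<notin> A" "w \<in> ends e" "w \<in> verts A \<union> R"
      using core(1) unfolding rooted_core_def by (elim conjE connected_toE)
    have "e \<notin> branch_edges R S" using crossing branch_eq unfolding A_def by blast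
    then have degree_two: "w \<notin> R" "card (incident S w) \<le> 2"
      using crossing unfolding branch_edges_def by auto
    then obtain e' where partner: "e' \<in> A" "w \<in> ends e'"
      using crossing unfolding verts_def by blast
    have "e \<noteq> e'" using crossing partner by blast
    have "{e, e'} \<subseteq> incident S w" using crossing partner unfolding incident_def A_def by blast
    then have "incident S w = {e, e'}"
      using degree_two(2) \<open>e \<noteq> e'\<close>
        card_seteq[OF finite_incident[OF core(2)], of "{e, e'}" w] by simp
    then have incident: "incident (S - X) w = {e, e'} - X" for X
      unfolding incident_def by blast
    have both_or_neither: "e \<in> X \<longleftrightarrow> e' \<in> X" if "leafless (S - X)" for X
    proof (rule ccontr)
      assume "\<not> (e \<in> X \<longleftrightarrow> e' \<in> X)"
      then have "{e, e'} - X = {e} \<or> {e, e'} - X = {e'}" using \<open>e \<noteq> e'\<close> by blast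
      then show False
        using that unfolding leafless_def incident[symmetric]
        by (metis One_nat_def card_1_singleton_iff)
    qed
    have "e \<in> T \<longleftrightarrow> e \<in> T'"
      using both_or_neither[OF leafless(1)] both_or_neither[OF leafless(2)] partner
      by (simp add: A_def)
    then show False using crossing by (simp add: A_def)
  qed
  then show ?thesis using subsets unfolding A_def by blast
qed

lemma sum_power_card_Pow:
  fixes D :: "'b::comm_semiring_1"
  assumes "finite B"
  shows "(\<Sum>Q\<in>Pow B. D ^ card Q) = (1 + D) ^ card B"
  using prod_add[OF assms, of "\<lambda>_. D" "\<lambda>_. 1"] by (simp add: add.commute)

lemma sum_power_card_branch_edges_le:
  fixes D :: real
  assumes "rooted_core R S" "finite S" "0 \<le> D"
  shows "(\<Sum>T | T \<subset> S \<and> leafless (S - T). D ^ card (branch_edges R S \<inter> T))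
    \<le> (1 + D) ^ card (branch_edges R S) - D ^ card (branch_edges R S)"
proof -
  let ?B = "branch_edges R S" and ?G = "{T. T \<subset> S \<and> leafless (S - T)}"
  have finite_B: "finite ?B" by (rule finite_branch_edges[OF assms(2)])
  have inj: "inj_on (\<lambda>T. ?B \<inter> T) ?G"
    by (rule inj_onI) (use leafless_Diff_eqI[OF assms(1,2)] in blast)
  have "leafless (S - S)" by (simp add: leafless_def incident_def)
  then have "?B \<inter> T \<noteq> ?B" if "T \<in> ?G" for T
    using leafless_Diff_eqI[OF assms(1,2), of T S] that branch_edges_subset[of R S] by blast
  then have image: "(\<lambda>T. ?B \<inter> T) ` ?G \<subseteq> Pow ?B - {?B}" by blast
  have "(\<Sum>T\<in>?G. D ^ card (?B \<inter> T)) = (\<Sum>Q\<in>(\<lambda>T. ?B \<inter> T) ` ?G. D ^ card Q)"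
    using inj by (simp add: sum.reindex)
  also have "\<dots> \<le> (\<Sum>Q\<in>Pow ?B - {?B}. D ^ card Q)"
    using finite_B image assms(3) by (intro sum_mono2) auto
  also have "\<dots> = (1 + D) ^ card ?B - D ^ card ?B"
    using finite_B by (simp add: sum_diff1 sum_power_card_Pow)
  finally show ?thesis .
qed

lemma one_plus_power_le_twice_power:
  fixes D :: real
  assumes "1 \<le> b" "4 * real b \<le> D"
  shows "1 + (1 + D) ^ b \<le> 2 * D ^ b"
proof -
  have D_ge: "4 \<le> D" using assms by simp
  have "1 + real b * (- (1 / (D + 1))) \<le> (1 + (- (1 / (D + 1)))) ^ b"
    using D_ge by (intro Bernoulli_inequality) simp
  moreover have "real b / (D + 1) \<le> 1 / 4"
    using assms by (simp add: field_simps)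
  ultimately have "3 / 4 \<le> (1 - 1 / (D + 1)) ^ b" by simp
  also have "1 - 1 / (D + 1) = D / (D + 1)" using D_ge by (simp add: field_simps)
  finally have "3 / 4 * (1 + D) ^ b \<le> D ^ b"
    using D_ge by (simp add: field_simps)
  moreover have "D ^ 1 \<le> D ^ b" using assms D_ge by (intro power_increasing) auto
  ultimately show ?thesis using D_ge by simp
qed

section \<open>Cumulants of centred edge signals\<close>

locale centred_edge_signal =
  fixes V :: "'v::linorder set" and K :: "'a set" and M :: "'v \<times> 'v \<Rightarrow> ('v \<Rightarrow> 'a) \<Rightarrow> real"
    and \<delta> :: real
  assumes finite_vertices: "finite V" and finite_labels: "finite K" and labels_nonempty: "K \<noteq> {}"
    and bound_nonneg: "0 \<le> \<delta>"
    and depends_on_signal: "depends_on (ends e) (M e)"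
    and abs_signal_le: "\<bar>M e x\<bar> \<le> 1"
    and resample_signal: "e \<in> edges_on V \<Longrightarrow> w \<in> ends e \<Longrightarrow> x \<in> PiE V (\<lambda>_. K)
      \<Longrightarrow> resample K w (M e) x = 0"
    and resample_abs_signal_le:
      "e \<in> edges_on V \<Longrightarrow> w \<in> ends e \<Longrightarrow> x \<in> PiE V (\<lambda>_. K)
      \<Longrightarrow> resample K w (\<lambda>x. \<bar>M e x\<bar>) x \<le> \<delta>"
begin

abbreviation labellings :: "('v \<Rightarrow> 'a) set" where
  "labellings \<equiv> PiE V (\<lambda>_. K)"

lemma finite_labellings: "finite labellings"
  by (intro finite_PiE finite_vertices finite_labels)

lemma labellings_nonempty: "labellings \<noteq> {}"
  using labels_nonempty by (simp add: PiE_eq_empty_iff)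

lemma mean_mult_resample_label:
  assumes "w \<in> V" "depends_on (- {w}) g"
  shows "mean labellings (\<lambda>x. g x * h x) = mean labellings (\<lambda>x. g x * resample K w h x)"
  using finite_vertices assms(1) finite_labels labels_nonempty assms(2) by (rule mean_mult_resample)

lemma mean_mult_signal_eq_0:
  assumes "e \<in> edges_on V" "w \<in> ends e" "depends_on (- {w}) g"
  shows "mean labellings (\<lambda>x. g x * M e x) = 0"
proof -
  have "w \<in> V" using assms(1,2) by (elim ends_edges_onE)
  then have "mean labellings (\<lambda>x. g x * M e x) = mean labellings (\<lambda>x. g x * resample K w (M e) x)"
    using assms(3) by (rule mean_mult_resample_label)
  also have "\<dots> = mean labellings (\<lambda>_. 0)"
    by (rule mean_cong) (simp add: resample_signal[OF assms(1,2)])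
  finally show ?thesis by (simp add: mean_def)
qed

lemma mean_mult_abs_signal_le:
  assumes "e \<in> edges_on V" "w \<in> ends e" "depends_on (- {w}) g" "\<And>x. 0 \<le> g x"
  shows "mean labellings (\<lambda>x. g x * \<bar>M e x\<bar>) \<le> \<delta> * mean labellings g"
proof -
  have "w \<in> V" using assms(1,2) by (elim ends_edges_onE)
  then have "mean labellings (\<lambda>x. g x * \<bar>M e x\<bar>)
      = mean labellings (\<lambda>x. g x * resample K w (\<lambda>x. \<bar>M e x\<bar>) x)"
    using assms(3) by (rule mean_mult_resample_label)
  also have "\<dots> \<le> mean labellings (\<lambda>x. \<delta> * g x)"
    using resample_abs_signal_le[OF assms(1,2)] assms(4)
    by (intro mean_mono) (simp add: mult.commute[of \<delta>] mult_left_mono)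
  finally show ?thesis by (simp add: mean_cmult)
qed

lemma depends_on_signal_prod: "depends_on (verts S) (\<lambda>x. \<Prod>e\<in>S. M e x)"
  by (intro depends_on_prod depends_on_mono[OF depends_on_signal]) (auto simp: verts_def)

lemma mean_mult_signal_prod_leaf:
  assumes "S \<subseteq> edges_on V" "incident S w = {e}" "depends_on (- {w}) g"
  shows "mean labellings (\<lambda>x. g x * (\<Prod>e\<in>S. M e x)) = 0"
proof -
  have leaf: "e \<in> S" "w \<in> ends e" using assms(2) by (auto simp: incident_def)
  have finite_S: "finite S" using finite_vertices assms(1) by (rule finite_subset_edges_on)
  have "verts (S - {e}) \<subseteq> - {w}"
    using assms(2) by (auto simp: verts_def incident_def)
  then have "depends_on (- {w}) (\<lambda>x. g x * (\<Prod>e\<in>S - {e}. M e x))"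
    by (intro depends_on_mult assms(3) depends_on_mono[OF depends_on_signal_prod])
  then have "mean labellings (\<lambda>x. g x * (\<Prod>e\<in>S - {e}. M e x) * M e x) = 0"
    using assms(1) leaf by (intro mean_mult_signal_eq_0[of e w]) auto
  then show ?thesis
    by (simp add: prod.remove[OF finite_S leaf(1)] mult_ac)
qed

lemma mean_mult_abs_signal_touching_le:
  assumes "e \<in> edges_on V" "w \<in> ends e" "w \<in> U" "depends_on U g" "\<And>x. 0 \<le> g x"
  shows "mean labellings (\<lambda>x. g x * \<bar>M e x\<bar>) \<le> \<delta> ^ card (ends e - U) * mean labellings g"
proof -
  obtain z where ends: "ends e = {w, z}" "w \<noteq> z" using assms(1,2) by (elim ends_edges_onE)
  show ?thesis
  proof (cases "z \<in> U")
    case True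
    then have "ends e - U = {}" using ends(1) assms(3) by simp
    moreover have "mean labellings (\<lambda>x. g x * \<bar>M e x\<bar>) \<le> mean labellings g"
      using assms(5) by (intro mean_mono mult_left_le abs_signal_le)
    ultimately show ?thesis by (metis card.empty mult_1 power_0)
  next
    case False
    then have "ends e - U = {z}" using ends(1) assms(3) by auto
    moreover have "mean labellings (\<lambda>x. g x * \<bar>M e x\<bar>) \<le> \<delta> * mean labellings g"
      using False ends(1)
      by (intro mean_mult_abs_signal_le[OF assms(1), of z] depends_on_mono[OF assms(4)] assms(5))
        auto
    ultimately show ?thesis by simp
  qed
qed

lemma mean_mult_abs_signal_prod_le:
  assumes "S \<subseteq> edges_on V" "connected_to U S" "depends_on U g" "\<And>x. 0 \<le> g x"
  shows "mean labellings (\<lambda>x. g x * \<bar>\<Prod>e\<in>S. M e x\<bar>) \<le> \<delta> ^ card (verts S - U) * mean labellings g"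
  using finite_subset_edges_on[OF finite_vertices assms(1)] assms
proof (induction S arbitrary: U g rule: finite_psubset_induct)
  case (psubset S)
  show ?case
  proof (cases "S = {}")
    case True
    then show ?thesis by (simp add: verts_empty)
  next
    case False
    then obtain e w where touching: "e \<in> S" "w \<in> ends e" "w \<in> U"
      using psubset.prems(2) by (elim connected_to_nonemptyE)
    let ?S = "S - {e}" and ?g = "\<lambda>x. g x * \<bar>M e x\<bar>" and ?U = "ends e \<union> U"
    have "verts S = ends e \<union> verts ?S"
      using touching(1) verts_insert[of e ?S] by (simp add: insert_absorb)
    then have "verts S - U = (verts ?S - ?U) \<union> (ends e - U)" by blast
    then have card_split: "card (verts S - U) = card (verts ?S - ?U) + card (ends e - U)"
      using psubset.hyps by (simp only:) (rule card_Un_disjoint, auto simp: finite_verts ends_def)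
    have "mean labellings (\<lambda>x. g x * \<bar>\<Prod>e\<in>S. M e x\<bar>) = mean labellings (\<lambda>x. ?g x * \<bar>\<Prod>e\<in>?S. M e x\<bar>)"
      by (simp add: prod.remove[OF psubset.hyps touching(1)] abs_mult mult.assoc)
    also have "\<dots> \<le> \<delta> ^ card (verts ?S - ?U) * mean labellings ?g"
    proof (rule psubset.IH)
      show "connected_to ?U ?S"
        using connected_to_Diff[OF psubset.prems(2), of "{e}"] touching(1)
        by (simp add: verts_insert verts_empty)
      show "depends_on ?U ?g"
        by (intro depends_on_mult depends_on_abs depends_on_mono[OF depends_on_signal]
            depends_on_mono[OF psubset.prems(3)]) auto
    qed (use touching(1) psubset.prems in auto)
    also have "\<dots> \<le> \<delta> ^ card (verts ?S - ?U) * (\<delta> ^ card (ends e - U) * mean labellings g)"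
      using touching psubset.prems bound_nonneg
      by (intro mult_left_mono mean_mult_abs_signal_touching_le[of e w]) auto
    finally show ?thesis by (simp add: card_split power_add mult.assoc)
  qed
qed

lemma mean_mult_indep_signal_prod:
  assumes "B \<subseteq> edges_on V" "depends_on (- verts B) g"
  shows "mean labellings (\<lambda>x. g x * (\<Prod>e\<in>B. M e x))
      = mean labellings g * mean labellings (\<lambda>x. \<Prod>e\<in>B. M e x)"
  by (rule mean_mult_indep[OF finite_vertices finite_labels labels_nonempty
        verts_subset_edges_on[OF assms(1)] assms(2) depends_on_signal_prod])

lemma abs_mean_signal_prod_Diff_le:
  assumes "S \<subseteq> edges_on V" "connected_to R S" "T \<subseteq> S"
  shows "\<bar>mean labellings (\<lambda>x. \<Prod>e\<in>S - T. M e x)\<bar> \<le> \<delta> ^ card (verts S - (verts T \<union> R))"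
proof -
  have "verts S = verts (S - T) \<union> verts T"
    using assms(3) verts_Un[of "S - T" T] by (simp add: Un_absorb2)
  then have verts: "verts S - (verts T \<union> R) = verts (S - T) - (verts T \<union> R)" by blast
  have "\<bar>mean labellings (\<lambda>x. \<Prod>e\<in>S - T. M e x)\<bar> \<le> mean labellings (\<lambda>x. 1 * \<bar>\<Prod>e\<in>S - T. M e x\<bar>)"
    by (simp add: abs_mean_le)
  also have "\<dots> \<le> \<delta> ^ card (verts (S - T) - (verts T \<union> R)) * mean labellings (\<lambda>_. 1)"
    using assms by (intro mean_mult_abs_signal_prod_le connected_to_Diff depends_on_const) auto
  finally show ?thesis by (simp add: verts mean_const finite_labellings labellings_nonempty)
qed

end

locale edge_cumulant = centred_edge_signal V K M \<delta>
  for V :: "'v::linorder set" and K :: "'a set" and M \<delta> +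
  fixes e0 :: "'v \<times> 'v"
  assumes target_edge: "e0 \<in> edges_on V"
begin

abbreviation roots :: "'v set" where
  "roots \<equiv> ends e0"

abbreviation \<kappa> :: "('v \<times> 'v) set \<Rightarrow> real" where
  "\<kappa> \<equiv> cumulant labellings (M e0) M"

lemma cumulant_leaf_eq_0:
  assumes "S \<subseteq> edges_on V" "w \<notin> roots" "incident S w = {e}"
  shows "\<kappa> S = 0"
proof (rule cumulant_eq_0_if_moments_eq_0)
  show "finite S" using finite_vertices assms(1) by (rule finite_subset_edges_on)
  show "e \<in> S" using assms(3) by (auto simp: incident_def)
next
  fix T assume "T \<subseteq> S" "e \<in> T"
  then have leaf_T: "T \<subseteq> edges_on V" "incident T w = {e}"
    using assms(1,3) by (auto simp: incident_def)
  have "depends_on (- {w}) (M e0)"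
    using assms(2) by (intro depends_on_mono[OF depends_on_signal]) auto
  with leaf_T show "mean labellings (\<lambda>x. M e0 x * (\<Prod>e\<in>T. M e x)) = 0"
    by (rule mean_mult_signal_prod_leaf)
  show "mean labellings (\<lambda>x. \<Prod>e\<in>T. M e x) = 0"
    using mean_mult_signal_prod_leaf[OF leaf_T depends_on_const[of _ 1]] by simp
qed

lemma cumulant_disconnected_eq_0:
  assumes "A \<union> B \<subseteq> edges_on V" "B \<noteq> {}" "verts B \<inter> (verts A \<union> roots) = {}"
  shows "\<kappa> (A \<union> B) = 0"
proof (rule cumulant_eq_0_if_indep[OF finite_labellings labellings_nonempty _ _ assms(2)])
  show "finite (A \<union> B)" using finite_vertices assms(1) by (rule finite_subset_edges_on)
  show "A \<inter> B = {}" using assms(3) by (fastforce simp: verts_def ends_def)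
next
  fix C D assume subsets: "C \<subseteq> A" "D \<subseteq> B"
  then have "verts C \<subseteq> verts A" "verts D \<subseteq> verts B" by (auto intro!: verts_mono)
  then have disj: "verts C \<subseteq> - verts D" "roots \<subseteq> - verts D" using assms(3) by auto
  have D_edges: "D \<subseteq> edges_on V" using subsets assms(1) by blast
  have C_depends: "depends_on (- verts D) (\<lambda>x. \<Prod>e\<in>C. M e x)"
    using disj(1) by (rule depends_on_mono[OF depends_on_signal_prod])
  then show "mean labellings (\<lambda>x. (\<Prod>e\<in>C. M e x) * (\<Prod>e\<in>D. M e x))
      = mean labellings (\<lambda>x. \<Prod>e\<in>C. M e x) * mean labellings (\<lambda>x. \<Prod>e\<in>D. M e x)"
    by (rule mean_mult_indep_signal_prod[OF D_edges])
  show "mean labellings (\<lambda>x. M e0 x * (\<Prod>e\<in>C. M e x) * (\<Prod>e\<in>D. M e x))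
      = mean labellings (\<lambda>x. M e0 x * (\<Prod>e\<in>C. M e x)) * mean labellings (\<lambda>x. \<Prod>e\<in>D. M e x)"
    using disj(2) C_depends
    by (intro mean_mult_indep_signal_prod[OF D_edges] depends_on_mult
        depends_on_mono[OF depends_on_signal])
qed

lemma cumulant_empty: "\<kappa> {} = 0"
  using mean_mult_signal_eq_0[OF target_edge _ depends_on_const[of _ 1], of "fst e0"]
  by (simp add: cumulant_eq ends_def)

lemma rooted_core_if_cumulant_nonzero:
  assumes "S \<subseteq> edges_on V" "\<kappa> S \<noteq> 0"
  shows "rooted_core roots S"
  unfolding rooted_core_def
proof (intro conjI ballI)
  show "S \<noteq> {}" using assms(2) cumulant_empty by auto
  show "connected_to roots S"
    unfolding connected_to_def
  proof (intro allI impI, rule ccontr)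
    fix A assume proper: "A \<subset> S" and "\<not> (\<exists>e\<in>S - A. ends e \<inter> (verts A \<union> roots) \<noteq> {})"
    then have "verts (S - A) \<inter> (verts A \<union> roots) = {}" by (auto simp: verts_def)
    moreover have "A \<union> (S - A) = S" using proper by auto
    ultimately show False using cumulant_disconnected_eq_0[of A "S - A"] proper assms by auto
  qed
  fix w assume non_root: "w \<in> verts S - roots"
  then have "incident S w \<noteq> {}" by (auto simp: verts_def incident_def)
  then have "card (incident S w) \<noteq> 0"
    using finite_incident[OF finite_subset_edges_on[OF finite_vertices assms(1)]] by simp
  moreover have "card (incident S w) \<noteq> 1"
    using cumulant_leaf_eq_0[OF assms(1)] non_root assms(2) by (auto simp: card_1_singleton_iff)
  ultimately show "2 \<le> card (incident S w)" by linarith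
qed

lemma abs_mean_target_signal_prod_le:
  assumes "S \<subseteq> edges_on V" "connected_to roots S"
  shows "\<bar>mean labellings (\<lambda>x. M e0 x * (\<Prod>e\<in>S. M e x))\<bar> \<le> \<delta> ^ (card (verts S - roots) + 1)"
proof -
  have "\<bar>mean labellings (\<lambda>x. M e0 x * (\<Prod>e\<in>S. M e x))\<bar>
      \<le> mean labellings (\<lambda>x. \<bar>M e0 x\<bar> * \<bar>\<Prod>e\<in>S. M e x\<bar>)"
    using abs_mean_le[of labellings "\<lambda>x. M e0 x * (\<Prod>e\<in>S. M e x)"] by (simp only: abs_mult)
  also have "\<dots> \<le> \<delta> ^ card (verts S - roots) * mean labellings (\<lambda>x. \<bar>M e0 x\<bar>)"
    using assms by (intro mean_mult_abs_signal_prod_le depends_on_abs depends_on_signal) auto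
  also have "\<dots> \<le> \<delta> ^ card (verts S - roots) * \<delta>"
    using mean_mult_abs_signal_le[OF target_edge _ depends_on_const[of _ 1], of "fst e0"]
      bound_nonneg
    by (intro mult_left_mono)
      (simp_all add: ends_def mean_const finite_labellings labellings_nonempty)
  finally show ?thesis by (simp add: mult.commute)
qed

lemma cumulant_eq_leafless:
  assumes "S \<subseteq> edges_on V"
  shows "\<kappa> S = mean labellings (\<lambda>x. M e0 x * (\<Prod>e\<in>S. M e x))
    - (\<Sum>T | T \<subset> S \<and> leafless (S - T). \<kappa> T * mean labellings (\<lambda>x. \<Prod>e\<in>S - T. M e x))"
proof -
  have finite_S: "finite S" using finite_vertices assms by (rule finite_subset_edges_on)
  have "mean labellings (\<lambda>x. \<Prod>e\<in>S - T. M e x) = 0" if leaf: "\<not> leafless (S - T)" for T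
  proof -
    obtain w where "card (incident (S - T) w) = 1"
      using leaf unfolding leafless_def by blast
    then obtain e where "incident (S - T) w = {e}" by (rule card_1_singletonE)
    then show ?thesis
      using mean_mult_signal_prod_leaf[OF _ _ depends_on_const[of _ 1], of "S - T" w e] assms
      by auto
  qed
  then have "(\<Sum>T | T \<subset> S. \<kappa> T * mean labellings (\<lambda>x. \<Prod>e\<in>S - T. M e x))
      = (\<Sum>T | T \<subset> S \<and> leafless (S - T). \<kappa> T * mean labellings (\<lambda>x. \<Prod>e\<in>S - T. M e x))"
    using finite_S by (intro sum.mono_neutral_right) (auto intro: finite_subset[of _ "Pow S"])
  then show ?thesis by (simp add: cumulant_eq[OF finite_S])
qed

lemma abs_cumulant_mult_mean_le:
  assumes "S \<subseteq> edges_on V" "connected_to roots S" "T \<subseteq> S" "1 \<le> D"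
    and smaller: "\<bar>\<kappa> T\<bar> \<le> \<delta> ^ (card (verts T - roots) + 1) * D ^ card (branch_edges roots T)"
  shows "\<bar>\<kappa> T * mean labellings (\<lambda>x. \<Prod>e\<in>S - T. M e x)\<bar>
    \<le> \<delta> ^ (card (verts S - roots) + 1) * D ^ card (branch_edges roots S \<inter> T)"
proof -
  have finite_S: "finite S" using finite_vertices assms(1) by (rule finite_subset_edges_on)
  have "verts S - roots = (verts T - roots) \<union> (verts S - (verts T \<union> roots))"
    using verts_mono[OF assms(3)] by blast
  then have card_split: "card (verts S - roots)
      = card (verts T - roots) + card (verts S - (verts T \<union> roots))"
    using finite_verts[OF finite_S] finite_verts[OF finite_subset[OF assms(3) finite_S]]
    by (simp only:) (rule card_Un_disjoint, auto)
  have "D ^ card (branch_edges roots T) \<le> D ^ card (branch_edges roots S \<inter> T)"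
    using branch_edges_mono[OF finite_S assms(3)] finite_branch_edges[OF finite_S] assms(4)
    by (intro power_increasing card_mono) auto
  then have "\<bar>\<kappa> T\<bar> \<le> \<delta> ^ (card (verts T - roots) + 1) * D ^ card (branch_edges roots S \<inter> T)"
    using bound_nonneg by (intro order_trans[OF smaller] mult_left_mono) auto
  then have "\<bar>\<kappa> T * mean labellings (\<lambda>x. \<Prod>e\<in>S - T. M e x)\<bar>
      \<le> (\<delta> ^ (card (verts T - roots) + 1) * D ^ card (branch_edges roots S \<inter> T))
        * \<delta> ^ card (verts S - (verts T \<union> roots))"
    unfolding abs_mult using assms(4) bound_nonneg
    by (intro mult_mono abs_mean_signal_prod_Diff_le assms(1-3)) auto
  then show ?thesis by (simp add: card_split power_add mult_ac)
qed

lemma abs_cumulant_recursion: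
  assumes "S \<subseteq> edges_on V" "rooted_core roots S" "1 \<le> D"
    and smaller: "\<And>T. T \<subset> S
      \<Longrightarrow> \<bar>\<kappa> T\<bar> \<le> \<delta> ^ (card (verts T - roots) + 1) * D ^ card (branch_edges roots T)"
  shows "\<bar>\<kappa> S\<bar> \<le> \<delta> ^ (card (verts S - roots) + 1)
    * (1 + (1 + D) ^ card (branch_edges roots S) - D ^ card (branch_edges roots S))"
proof -
  let ?B = "branch_edges roots S" and ?G = "{T. T \<subset> S \<and> leafless (S - T)}"
  define \<Delta> where "\<Delta> = \<delta> ^ (card (verts S - roots) + 1)"
  have finite_S: "finite S" using finite_vertices assms(1) by (rule finite_subset_edges_on)
  have connected: "connected_to roots S" using assms(2) by (simp add: rooted_core_def)
  have term_le: "\<bar>\<kappa> T * mean labellings (\<lambda>x. \<Prod>e\<in>S - T. M e x)\<bar> \<le> \<Delta> * D ^ card (?B \<inter> T)"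
    if "T \<subset> S" for T
    unfolding \<Delta>_def using that
    by (intro abs_cumulant_mult_mean_le assms(1,3) connected smaller) auto
  have "\<bar>\<Sum>T\<in>?G. \<kappa> T * mean labellings (\<lambda>x. \<Prod>e\<in>S - T. M e x)\<bar> \<le> (\<Sum>T\<in>?G. \<Delta> * D ^ card (?B \<inter> T))"
    by (rule order_trans[OF sum_abs sum_mono]) (use term_le in auto)
  also have "\<dots> \<le> \<Delta> * ((1 + D) ^ card ?B - D ^ card ?B)"
    unfolding sum_distrib_left[symmetric] using assms(3) bound_nonneg
    by (intro mult_left_mono sum_power_card_branch_edges_le assms(2) finite_S) (auto simp: \<Delta>_def)
  finally have "\<bar>\<kappa> S\<bar> \<le> \<Delta> + \<Delta> * ((1 + D) ^ card ?B - D ^ card ?B)"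
    unfolding cumulant_eq_leafless[OF assms(1)]
    using abs_mean_target_signal_prod_le[OF assms(1) connected] by (simp add: \<Delta>_def)
  then show ?thesis by (simp add: \<Delta>_def algebra_simps)
qed

lemma abs_cumulant_le:
  assumes "S \<subseteq> edges_on V" "4 * real (card S) \<le> D"
  shows "\<bar>\<kappa> S\<bar> \<le> \<delta> ^ (card (verts S - roots) + 1) * D ^ card (branch_edges roots S)"
  using finite_subset_edges_on[OF finite_vertices assms(1)] assms
proof (induction S rule: finite_psubset_induct)
  case (psubset S)
  show ?case
  proof (cases "\<kappa> S = 0")
    case True
    then show ?thesis using psubset.prems(2) bound_nonneg by simp
  next
    case False
    let ?B = "branch_edges roots S"
    have core: "rooted_core roots S"
      using psubset.prems(1) False by (rule rooted_core_if_cumulant_nonzero)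
    have card_B: "1 \<le> card ?B" "card ?B \<le> card S"
      using branch_edges_nonempty[OF core] psubset.hyps
      by (simp_all add: Suc_le_eq card_gt_0_iff finite_branch_edges card_mono branch_edges_subset)
    then have D_ge: "1 \<le> D" "4 * real (card ?B) \<le> D" using psubset.prems(2) by linarith+
    have "4 * real (card T) \<le> D" if "T \<subset> S" for T
      using psubset_card_mono[OF psubset.hyps that] psubset.prems(2) by linarith
    then have "\<bar>\<kappa> S\<bar> \<le> \<delta> ^ (card (verts S - roots) + 1) * (1 + (1 + D) ^ card ?B - D ^ card ?B)"
      using psubset.prems(1) by (intro abs_cumulant_recursion core D_ge psubset.IH) auto
    also have "\<dots> \<le> \<delta> ^ (card (verts S - roots) + 1) * D ^ card ?B"
      using one_plus_power_le_twice_power[OF card_B(1) D_ge(2)] bound_nonneg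
      by (intro mult_left_mono) auto
    finally show ?thesis .
  qed
qed

end

section \<open>Counting rooted cores\<close>

definition edge :: "'v::linorder \<Rightarrow> 'v \<Rightarrow> 'v \<times> 'v" where
  "edge a b = (min a b, max a b)"

lemma ends_edge: "ends (edge a b) = {a, b}"
  by (auto simp: ends_def edge_def min_def max_def)

lemma edge_eqI: "e \<in> edges_on V \<Longrightarrow> ends e = {a, b} \<Longrightarrow> e = edge a b"
  by (auto simp: ends_def edge_def edges_on_def doubleton_eq_iff)

lemma edge_in_edges_on: "a \<in> V \<Longrightarrow> b \<in> V \<Longrightarrow> a \<noteq> b \<Longrightarrow> edge a b \<in> edges_on V"
  by (auto simp: edge_def edges_on_def min_def max_def)

text \<open>A state records an edge set and the vertex at which the exploration currently stands. A step
  to a fresh vertex continues from there and costs a factor \<open>|V|\<close>; a step closing a cycle costs two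
  choices among the few vertices seen so far. In a rooted core the exploration is never stuck at a
  fresh vertex.\<close>

inductive explores :: "'v::linorder set \<Rightarrow> 'v set \<Rightarrow> nat \<Rightarrow> nat \<Rightarrow> ('v \<times> 'v) set \<Rightarrow> 'v \<Rightarrow> bool"
  for V R where
  start: "z \<in> R \<Longrightarrow> explores V R 0 0 {} z"
| fresh: "explores V R p j H z \<Longrightarrow> w \<in> V \<Longrightarrow> w \<notin> verts H \<union> R
    \<Longrightarrow> explores V R (Suc p) j (insert (edge z w) H) w"
| close: "explores V R p j H z \<Longrightarrow> t \<in> verts H \<union> R \<Longrightarrow> s \<in> verts H \<union> R \<Longrightarrow> edge z t \<notin> H
    \<Longrightarrow> explores V R p (Suc j) (insert (edge z t) H) s"

lemma explores_invariants:
  "explores V R p j H z \<Longrightarrow> finite H \<and> z \<in> verts H \<union> R \<and> card H = p + j \<and> card (verts H - R) = p"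
proof (induction rule: explores.induct)
  case (start z)
  then show ?case by (simp add: verts_empty)
next
  case (fresh p j H z w)
  have "edge z w \<notin> H"
  proof
    assume "edge z w \<in> H"
    then have "w \<in> verts H" using ends_edge[of z w] unfolding verts_def by blast
    then show False using fresh by simp
  qed
  moreover have "verts (insert (edge z w) H) - R = insert w (verts H - R)"
    using fresh by (auto simp: verts_insert ends_edge)
  ultimately show ?case
    using fresh by (simp add: finite_verts verts_insert ends_edge)
next
  case (close p j H z t s)
  then have "verts (insert (edge z t) H) - R = verts H - R"
    by (auto simp: verts_insert ends_edge)
  then show ?case
    using close by (auto simp: verts_insert)
qed

lemma rooted_core_next_edge:
  assumes "rooted_core R S" "finite S" "e \<in> S" "w \<in> ends e" "w \<notin> verts H \<union> R"
  obtains e' where "e' \<in> S - insert e H" "w \<in> ends e'"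
proof -
  have "w \<in> verts S - R" using assms(3-5) unfolding verts_def by blast
  then have "2 \<le> card (incident S w)" using assms(1) by (simp add: rooted_core_def)
  then have "\<not> incident S w \<subseteq> {e}"
    using card_mono[of "{e}" "incident S w"] by auto
  then obtain e' where other: "e' \<in> S" "w \<in> ends e'" "e' \<noteq> e"
    unfolding incident_def by blast
  then have "e' \<notin> H" using assms(5) unfolding verts_def by blast
  then show thesis using that other by blast
qed

lemma explores_extend:
  assumes "rooted_core R S" "S \<subseteq> edges_on V" "finite S"
    and "explores V R p j H z" "H \<subset> S" "e \<in> S - H" "z \<in> ends e"
  obtains p' j' s where "explores V R p' j' (insert e H) s"
    and "insert e H = S \<or> (\<exists>e'\<in>S - insert e H. s \<in> ends e')"
proof -
  have "e \<in> edges_on V" using assms(2,6) by blast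
  then obtain y where ends: "ends e = {z, y}" "y \<in> V"
    using assms(7) by (rule ends_edges_onE)
  have e_eq: "e = edge z y" using \<open>e \<in> edges_on V\<close> ends(1) by (rule edge_eqI)
  have z_seen: "z \<in> verts H \<union> R" using explores_invariants[OF assms(4)] by blast
  show thesis
  proof (cases "y \<in> verts H \<union> R")
    case False
    then have "explores V R (Suc p) j (insert e H) y"
      unfolding e_eq using assms(4) ends(2) by (intro explores.fresh)
    moreover obtain e' where "e' \<in> S - insert e H" "y \<in> ends e'"
      by (rule rooted_core_next_edge[OF assms(1,3) _ _ False, of e])
        (use that assms(6) ends(1) in auto)
    ultimately show thesis using that by blast
  next
    case True
    have close: "explores V R p (Suc j) (insert e H) s" if "s \<in> verts H \<union> R" for s
      using assms(4,6) True that unfolding e_eq by (intro explores.close) auto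
    show thesis
    proof (cases "insert e H = S")
      case True
      then show thesis using that close[OF z_seen] by blast
    next
      case False
      then have "insert e H \<subset> S" using assms(5,6) by blast
      then obtain e' s where crossing: "e' \<in> S" "e' \<notin> insert e H"
          "s \<in> ends e'" "s \<in> verts (insert e H) \<union> R"
        using assms(1) unfolding rooted_core_def by (elim conjE connected_toE)
      have "s \<in> verts H \<union> R"
        using crossing(4) ends(1) z_seen \<open>y \<in> verts H \<union> R\<close> by (auto simp: verts_insert)
      then show thesis using that close crossing by blast
    qed
  qed
qed

lemma explores_completed:
  assumes "rooted_core R S" "S \<subseteq> edges_on V" "finite S"
    and "explores V R p j H z" "H \<subset> S" "e \<in> S - H" "z \<in> ends e"
  shows "\<exists>p j z. explores V R p j S z"
  using assms(4-)
proof (induction "card (S - H)" arbitrary: H p j z e rule: less_induct)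
  case (less H p j z e)
  obtain p' j' s where step: "explores V R p' j' (insert e H) s"
    "insert e H = S \<or> (\<exists>e'\<in>S - insert e H. s \<in> ends e')"
    using assms(1-3) less.prems by (rule explores_extend)
  show ?case
  proof (cases "insert e H = S")
    case True
    then show ?thesis using step(1) by blast
  next
    case False
    then obtain e' where next_edge: "e' \<in> S - insert e H" "s \<in> ends e'" using step(2) by blast
    have smaller: "card (S - insert e H) < card (S - H)"
      using assms(3) less.prems(3) by (intro psubset_card_mono) auto
    have "insert e H \<subset> S" using False less.prems(2,3) by blast
    then show ?thesis by (rule less.hyps[OF smaller step(1) _ next_edge])
  qed
qed

lemma rooted_core_explored:
  assumes "rooted_core R S" "S \<subseteq> edges_on V" "finite S" "card (verts S - R) = p" "card S = p + j"
  shows "\<exists>z. explores V R p j S z"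
proof -
  have "S \<noteq> {}" "connected_to R S" using assms(1) by (auto simp: rooted_core_def)
  then obtain e w where "e \<in> S" "w \<in> ends e" "w \<in> R"
    by (elim connected_to_nonemptyE)
  then obtain p' j' z where explores: "explores V R p' j' S z"
    using explores_completed[OF assms(1-3) explores.start, of w e] \<open>S \<noteq> {}\<close> by blast
  then have "p' = p" "j' = j"
    using explores_invariants[OF explores] assms(4,5) by auto
  then show ?thesis using explores by blast
qed

definition explored :: "'v::linorder set \<Rightarrow> 'v set \<Rightarrow> nat \<Rightarrow> nat \<Rightarrow> (('v \<times> 'v) set \<times> 'v) set" where
  "explored V R p j = {(H, z). explores V R p j H z}"

definition fresh_steps :: "'v::linorder set \<Rightarrow> (('v \<times> 'v) set \<times> 'v) set
    \<Rightarrow> (('v \<times> 'v) set \<times> 'v) set" where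
  "fresh_steps V Q = (\<Union>(H, z)\<in>Q. (\<lambda>w. (insert (edge z w) H, w)) ` V)"

definition closing_steps :: "'v::linorder set \<Rightarrow> (('v \<times> 'v) set \<times> 'v) set
    \<Rightarrow> (('v \<times> 'v) set \<times> 'v) set" where
  "closing_steps R Q =
    (\<Union>(H, z)\<in>Q. (\<lambda>(t, s). (insert (edge z t) H, s)) ` ((verts H \<union> R) \<times> (verts H \<union> R)))"

lemma
  shows explored_0_0: "explored V R 0 0 = {{}} \<times> R"
    and explored_Suc_0: "explored V R (Suc p) 0 \<subseteq> fresh_steps V (explored V R p 0)"
    and explored_0_Suc: "explored V R 0 (Suc j) \<subseteq> closing_steps R (explored V R 0 j)"
    and explored_Suc_Suc: "explored V R (Suc p) (Suc j)
      \<subseteq> fresh_steps V (explored V R p (Suc j)) \<union> closing_steps R (explored V R (Suc p) j)"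
  unfolding explored_def fresh_steps_def closing_steps_def
  by (auto elim: explores.cases intro: explores.start) (force elim: explores.cases)+

lemma card_UN_le_mult:
  assumes "finite I" "\<And>i. i \<in> I \<Longrightarrow> card (A i) \<le> m"
  shows "card (\<Union>i\<in>I. A i) \<le> card I * m"
  using card_UN_le[OF assms(1), of A] sum_bounded_above[of I "\<lambda>i. card (A i)" m] assms(2) by simp

lemma finite_fresh_steps: "finite Q \<Longrightarrow> finite V \<Longrightarrow> finite (fresh_steps V Q)"
  by (auto simp: fresh_steps_def)

lemma card_fresh_steps_le:
  assumes "finite Q" "finite V"
  shows "card (fresh_steps V Q) \<le> card Q * card V"
  unfolding fresh_steps_def using assms
  by (intro card_UN_le_mult) (auto simp: card_image_le)

lemma finite_closing_steps_explored:
  assumes "finite (explored V R p j)" "finite R"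
  shows "finite (closing_steps R (explored V R p j))"
  unfolding closing_steps_def using assms
  by (intro finite_UN_I) (auto simp: explored_def finite_verts dest: explores_invariants)

lemma card_closing_steps_explored_le:
  assumes "finite (explored V R p j)" "finite R"
  shows "card (closing_steps R (explored V R p j)) \<le> card (explored V R p j) * (p + card R)\<^sup>2"
  unfolding closing_steps_def
proof (rule card_UN_le_mult[OF assms(1)], clarify)
  fix H z assume "(H, z) \<in> explored V R p j"
  then have seen: "finite (verts H \<union> R)" "card (verts H - R) = p"
    using assms(2) by (auto simp: explored_def finite_verts dest: explores_invariants)
  have "card (verts H \<union> R) \<le> p + card R"
    using card_Un_le[of "verts H - R" R] seen(2) by simp
  then have "card ((verts H \<union> R) \<times> (verts H \<union> R)) \<le> (p + card R)\<^sup>2"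
    unfolding card_cartesian_product power2_eq_square by (intro mult_mono) auto
  then show "card ((\<lambda>(t, s). (insert (edge z t) H, s)) ` ((verts H \<union> R) \<times> (verts H \<union> R)))
      \<le> (p + card R)\<^sup>2"
    using seen(1) by (intro order_trans[OF card_image_le]) auto
qed

lemma card_explored_Suc_0_le:
  assumes "finite V" "finite (explored V R p 0)"
  shows "finite (explored V R (Suc p) 0) \<and> card (explored V R (Suc p) 0)
      \<le> card (explored V R p 0) * card V"
  using finite_fresh_steps[OF assms(2,1)] card_fresh_steps_le[OF assms(2,1)]
  by (meson card_mono explored_Suc_0 finite_subset order_trans)

lemma card_explored_0_Suc_le:
  assumes "finite R" "finite (explored V R 0 j)"
  shows "finite (explored V R 0 (Suc j)) \<and> card (explored V R 0 (Suc j))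
      \<le> card (explored V R 0 j) * (card R)\<^sup>2"
  using finite_closing_steps_explored[OF assms(2,1)] card_closing_steps_explored_le[OF assms(2,1)]
  by (simp only: add_0) (meson card_mono explored_0_Suc finite_subset order_trans)

lemma card_explored_Suc_Suc_le:
  assumes "finite V" "finite R" "finite (explored V R p (Suc j))" "finite (explored V R (Suc p) j)"
  shows "finite (explored V R (Suc p) (Suc j)) \<and> card (explored V R (Suc p) (Suc j))
    \<le> card (explored V R p (Suc j)) * card V + card (explored V R (Suc p) j) * (Suc p + card R)\<^sup>2"
proof -
  let ?F = "fresh_steps V (explored V R p (Suc j))"
    and ?C = "closing_steps R (explored V R (Suc p) j)"
  have finite_steps: "finite (?F \<union> ?C)"
    using assms by (intro finite_UnI finite_fresh_steps finite_closing_steps_explored)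
  have "card (explored V R (Suc p) (Suc j)) \<le> card ?F + card ?C"
    using card_mono[OF finite_steps explored_Suc_Suc] card_Un_le by (rule order_trans)
  also have "\<dots> \<le> card (explored V R p (Suc j)) * card V
      + card (explored V R (Suc p) j) * (Suc p + card R)\<^sup>2"
    using assms by (intro add_mono card_fresh_steps_le card_closing_steps_explored_le)
  finally show ?thesis
    using finite_subset[OF explored_Suc_Suc finite_steps] by blast
qed

definition exploration_bound :: "nat \<Rightarrow> nat \<Rightarrow> nat \<Rightarrow> nat \<Rightarrow> nat" where
  "exploration_bound v r p j = (p + j choose p) * (r * v ^ p * (p + r) ^ (2 * j))"

lemma exploration_bound_0_0: "exploration_bound v r 0 0 = r"
  by (simp add: exploration_bound_def)

lemma exploration_bound_Suc_0: "exploration_bound v r (Suc p) 0 = exploration_bound v r p 0 * v"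
  by (simp add: exploration_bound_def mult_ac)

lemma exploration_bound_0_Suc: "exploration_bound v r 0 (Suc j) = exploration_bound v r 0 j * r\<^sup>2"
  by (simp add: exploration_bound_def power2_eq_square mult_ac)

lemma exploration_bound_Suc_Suc:
  "exploration_bound v r p (Suc j) * v + exploration_bound v r (Suc p) j * (Suc p + r)\<^sup>2
    \<le> exploration_bound v r (Suc p) (Suc j)"
proof -
  define m where "m = Suc p + r"
  have "(p + r) ^ (2 * Suc j) \<le> m ^ (2 * Suc j)"
    unfolding m_def by (rule power_mono) auto
  then have "exploration_bound v r p (Suc j) * v
      \<le> (p + Suc j choose p) * (r * v ^ p * m ^ (2 * Suc j)) * v"
    unfolding exploration_bound_def by (intro mult_right_mono mult_left_mono) auto
  moreover have "exploration_bound v r (Suc p) j * m\<^sup>2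
      = (p + Suc j choose Suc p) * (r * v ^ Suc p * m ^ (2 * Suc j))"
    unfolding exploration_bound_def m_def[symmetric] by (simp add: power2_eq_square)
  moreover have "(p + Suc j choose p) * (r * v ^ p * m ^ (2 * Suc j)) * v
      + (p + Suc j choose Suc p) * (r * v ^ Suc p * m ^ (2 * Suc j))
      = exploration_bound v r (Suc p) (Suc j)"
    unfolding exploration_bound_def m_def[symmetric] by (simp add: algebra_simps)
  ultimately show ?thesis unfolding m_def by linarith
qed

lemma card_explored_le:
  assumes "finite V" "finite R"
  shows "finite (explored V R p j) \<and> card (explored V R p j)
      \<le> exploration_bound (card V) (card R) p j"
proof (induction p arbitrary: j)
  case 0
  show ?case
  proof (induction j)
    case 0
    show ?case
      using assms(2) by (simp add: explored_0_0 exploration_bound_0_0 card_cartesian_product)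
  next
    case (Suc j)
    then have "card (explored V R 0 j) * (card R)\<^sup>2
        \<le> exploration_bound (card V) (card R) 0 j * (card R)\<^sup>2"
      by (intro mult_right_mono) auto
    with Suc show ?case
      using card_explored_0_Suc_le[OF assms(2), of V j]
      unfolding exploration_bound_0_Suc by linarith
  qed
next
  case (Suc p)
  note fresh_IH = Suc
  show ?case
  proof (induction j)
    case 0
    have "card (explored V R p 0) * card V \<le> exploration_bound (card V) (card R) p 0 * card V"
      using fresh_IH[of 0] by (intro mult_right_mono) auto
    with fresh_IH[of 0] show ?case
      using card_explored_Suc_0_le[OF assms(1), of R p]
      unfolding exploration_bound_Suc_0 by linarith
  next
    case (Suc j)
    let ?bound = "exploration_bound (card V) (card R)"
    have "card (explored V R p (Suc j)) * card V
          + card (explored V R (Suc p) j) * (Suc p + card R)\<^sup>2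
        \<le> ?bound p (Suc j) * card V + ?bound (Suc p) j * (Suc p + card R)\<^sup>2"
      using fresh_IH[of "Suc j"] Suc by (intro add_mono mult_right_mono) auto
    also have "\<dots> \<le> ?bound (Suc p) (Suc j)" by (rule exploration_bound_Suc_Suc)
    finally show ?case
      using card_explored_Suc_Suc_le[OF assms, of p j] fresh_IH[of "Suc j"] Suc by linarith
  qed
qed

definition rooted_cores :: "'v::linorder set \<Rightarrow> 'v set \<Rightarrow> nat \<Rightarrow> nat \<Rightarrow> ('v \<times> 'v) set set" where
  "rooted_cores V R p j =
    {S. S \<subseteq> edges_on V \<and> rooted_core R S \<and> card (verts S - R) = p \<and> card S = p + j}"

lemma card_rooted_cores_le:
  assumes "finite V" "finite R"
  shows "card (rooted_cores V R p j) \<le> exploration_bound (card V) (card R) p j"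
proof -
  have "rooted_cores V R p j \<subseteq> fst ` explored V R p j"
  proof
    fix S assume "S \<in> rooted_cores V R p j"
    then have "\<exists>z. explores V R p j S z"
      using finite_subset_edges_on[OF assms(1)]
      by (intro rooted_core_explored) (auto simp: rooted_cores_def)
    then show "S \<in> fst ` explored V R p j"
      by (force simp: explored_def)
  qed
  then have "card (rooted_cores V R p j) \<le> card (explored V R p j)"
    using card_explored_le[OF assms] by (meson card_image_le card_mono finite_imageI order_trans)
  then show ?thesis
    using card_explored_le[OF assms] by (meson order_trans)
qed

section \<open>The sum of squared cumulants\<close>

lemma sum_geometric_le_2:
  fixes x :: real
  assumes "0 \<le> x" "x \<le> 1 / 2"
  shows "(\<Sum>i<m. x ^ i) \<le> 2"
proof -
  have "(\<Sum>i<m. x ^ i) = (1 - x ^ m) / (1 - x)"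
    using assms by (simp add: sum_gp_strict)
  also have "\<dots> \<le> 1 / (1 / 2)"
    using assms by (intro frac_le) auto
  finally show ?thesis by simp
qed

lemma sum_geometric_mult_le:
  fixes \<rho> :: real
  assumes "0 \<le> \<rho>" "\<rho> \<le> 1 / 2"
  shows "(\<Sum>(p, j)\<in>{..l} \<times> {1..m}. (1 / 2) ^ p * \<rho> ^ j) \<le> 4 * \<rho>"
proof -
  have "(\<Sum>(p, j)\<in>{..l} \<times> {1..m}. (1 / 2) ^ p * \<rho> ^ j) = (\<Sum>p\<le>l. (1 / 2) ^ p) * (\<Sum>j=1..m. \<rho> ^ j)"
    by (simp add: sum_product sum.cartesian_product)
  also have "(\<Sum>j=1..m. \<rho> ^ j) = \<rho> * (\<Sum>i<m. \<rho> ^ i)"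
    by (simp add: sum.atLeast1_atMost_eq sum_distrib_left)
  also have "(\<Sum>p\<le>l. (1 / 2) ^ p) * (\<rho> * (\<Sum>i<m. \<rho> ^ i)) \<le> 2 * (\<rho> * 2)"
    using sum_geometric_le_2[of "1 / 2" "Suc l"] sum_geometric_le_2[OF assms, of m] assms
    by (intro mult_mono mult_left_mono)
      (auto simp: lessThan_Suc_atMost intro!: mult_nonneg_nonneg sum_nonneg)
  finally show ?thesis by simp
qed

lemma sum_le_sum_cover:
  fixes f :: "'a \<Rightarrow> real"
  assumes "finite A" "finite I" "\<And>i. i \<in> I \<Longrightarrow> finite (B i)" "\<And>x. 0 \<le> f x"
    and cover: "\<And>x. x \<in> A \<Longrightarrow> f x \<noteq> 0 \<Longrightarrow> \<exists>i\<in>I. x \<in> B i"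
  shows "sum f A \<le> (\<Sum>i\<in>I. sum f (B i))"
proof -
  have "sum f A = sum f {x \<in> A. f x \<noteq> 0}"
    using assms(1) by (intro sum.mono_neutral_right) auto
  also have "\<dots> \<le> sum f (\<Union>i\<in>I. B i)"
    using assms cover by (intro sum_mono2) auto
  also have "\<dots> \<le> (\<Sum>i\<in>I. sum f (B i))"
    using assms(2,3)
  proof (induction I rule: finite_induct)
    case (insert i I)
    have "0 \<le> sum f (B i \<inter> (\<Union>i\<in>I. B i))" using assms(4) by (rule sum_nonneg)
    then show ?case
      using insert sum.union_inter[of "B i" "\<Union>i\<in>I. B i" f] by simp
  qed simp
  finally show ?thesis .
qed

context edge_cumulant
begin

lemma card_roots: "card roots = 2"
  using target_edge by (rule card_ends)

lemma finite_roots: "finite roots"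
  by (simp add: ends_def)

lemma cumulant_sq_le:
  assumes "S \<in> rooted_cores V roots p j" "card S \<le> l" "0 \<le> L"
  shows "L ^ card S * (\<kappa> S)\<^sup>2 \<le> L ^ (p + j) * (\<delta> ^ (p + 1) * (4 * real l) ^ (6 * j))\<^sup>2"
proof -
  have core: "S \<subseteq> edges_on V" "rooted_core roots S" "card (verts S - roots) = p" "card S = p + j"
    using assms(1) by (auto simp: rooted_cores_def)
  have finite_S: "finite S" using finite_vertices core(1) by (rule finite_subset_edges_on)
  have branch: "card (branch_edges roots S) \<le> 6 * j"
    using card_branch_edges_le[OF core(2,1) finite_S finite_roots] core(3,4) by simp
  have "0 < card S" using core(2) finite_S by (auto simp: rooted_core_def card_gt_0_iff)
  then have base_ge_1: "1 \<le> 4 * real l" using assms(2) by simp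
  have "\<bar>\<kappa> S\<bar> \<le> \<delta> ^ (p + 1) * (4 * real l) ^ card (branch_edges roots S)"
    using abs_cumulant_le[OF core(1), of "4 * real l"] assms(2) core(3) by simp
  also have "\<dots> \<le> \<delta> ^ (p + 1) * (4 * real l) ^ (6 * j)"
    using base_ge_1 branch bound_nonneg by (intro mult_left_mono power_increasing) auto
  finally have "\<bar>\<kappa> S\<bar>\<^sup>2 \<le> (\<delta> ^ (p + 1) * (4 * real l) ^ (6 * j))\<^sup>2"
    by (intro power_mono) auto
  then show ?thesis
    unfolding core(4) power2_abs using assms(3) by (intro mult_left_mono) auto
qed

lemma card_rooted_cores_roots_le:
  assumes "p + j \<le> l"
  shows "real (card (rooted_cores V roots p j))
      \<le> 2 * (2 * real (card V)) ^ p * (2 * (real l + 2)\<^sup>2) ^ j"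
proof -
  have "card (rooted_cores V roots p j) \<le> (p + j choose p) * (2 * card V ^ p * (p + 2) ^ (2 * j))"
    using card_rooted_cores_le[OF finite_vertices finite_roots, of p j]
    by (simp add: card_roots exploration_bound_def)
  also have "\<dots> \<le> 2 ^ (p + j) * (2 * card V ^ p * (l + 2) ^ (2 * j))"
    using assms by (intro mult_mono power_mono binomial_le_pow2) auto
  finally have "real (card (rooted_cores V roots p j))
      \<le> real (2 ^ (p + j) * (2 * card V ^ p * (l + 2) ^ (2 * j)))"
    by (simp only: of_nat_le_iff)
  then show ?thesis
    by (simp add: power_add power_mult_distrib mult_ac add.commute flip: power_mult)
qed

lemma sum_cumulant_sq_shape_le:
  assumes weight: "0 \<le> L" "4 * real (card V) * L * \<delta>\<^sup>2 \<le> 1"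
    and ratio: "\<rho> = 2 * (real l + 2)\<^sup>2 * L * (4 * real l) ^ 12"
  shows "(\<Sum>S | S \<in> rooted_cores V roots p j \<and> card S \<le> l. L ^ card S * (\<kappa> S)\<^sup>2)
    \<le> 2 * \<delta>\<^sup>2 * ((1 / 2) ^ p * \<rho> ^ j)"
proof -
  let ?A = "{S. S \<in> rooted_cores V roots p j \<and> card S \<le> l}"
  let ?w = "L ^ (p + j) * (\<delta> ^ (p + 1) * (4 * real l) ^ (6 * j))\<^sup>2"
  have \<rho>_nonneg: "0 \<le> \<rho>" using ratio weight(1) by simp
  have regroup: "2 * A ^ p * B ^ j * (L ^ (p + j) * (\<delta> ^ (p + 1) * D ^ (6 * j))\<^sup>2)
      = 2 * \<delta>\<^sup>2 * ((A * L * \<delta>\<^sup>2) ^ p * (B * L * D ^ 12) ^ j)" for A B D :: real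
    by (simp add: power_add power_mult_distrib mult_ac flip: power_mult)
  show ?thesis
  proof (cases "p + j \<le> l")
    case False
    then have "?A = {}" by (auto simp: rooted_cores_def)
    show ?thesis unfolding \<open>?A = {}\<close> using \<rho>_nonneg by simp
  next
    case True
    then have "?A = rooted_cores V roots p j" by (auto simp: rooted_cores_def)
    moreover have "(\<Sum>S\<in>?A. L ^ card S * (\<kappa> S)\<^sup>2) \<le> real (card ?A) * ?w"
      using weight(1) by (intro sum_bounded_above cumulant_sq_le) auto
    ultimately have "(\<Sum>S\<in>?A. L ^ card S * (\<kappa> S)\<^sup>2) \<le> real (card (rooted_cores V roots p j)) * ?w"
      by simp
    also have "\<dots> \<le> 2 * (2 * real (card V)) ^ p * (2 * (real l + 2)\<^sup>2) ^ j * ?w"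
      using weight(1) card_rooted_cores_roots_le[OF True] by (intro mult_right_mono) auto
    also have "\<dots> = 2 * \<delta>\<^sup>2 * ((2 * real (card V) * L * \<delta>\<^sup>2) ^ p * \<rho> ^ j)"
      unfolding ratio by (rule regroup)
    also have "\<dots> \<le> 2 * \<delta>\<^sup>2 * ((1 / 2) ^ p * \<rho> ^ j)"
      using weight \<rho>_nonneg by (intro mult_left_mono mult_right_mono power_mono) auto
    finally show ?thesis .
  qed
qed

lemma cumulant_nonzero_rooted_cores:
  assumes "S \<in> subsets_upto (edges_on V) l" "\<kappa> S \<noteq> 0"
  obtains p j where "S \<in> rooted_cores V roots p j" "p \<le> l" "1 \<le> j" "j \<le> l"
proof -
  have edges: "S \<subseteq> edges_on V" "card S \<le> l" using assms(1) by (auto simp: subsets_upto_def)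
  have finite_S: "finite S" using finite_vertices edges(1) by (rule finite_subset_edges_on)
  have core: "rooted_core roots S" using edges(1) assms(2) by (rule rooted_core_if_cumulant_nonzero)
  have "0 < card (branch_edges roots S)"
    using branch_edges_nonempty[OF core] finite_branch_edges[OF finite_S]
    by (simp add: card_gt_0_iff)
  then have "card (verts S - roots) < card S"
    using card_branch_edges_le[OF core edges(1) finite_S finite_roots] by linarith
  then show thesis
    using edges core by (intro that[of "card (verts S - roots)" "card S - card (verts S - roots)"])
      (auto simp: rooted_cores_def)
qed

lemma sum_cumulant_sq_le:
  assumes weight: "0 \<le> L" "4 * real (card V) * L * \<delta>\<^sup>2 \<le> 1"
    and ratio: "\<rho> = 2 * (real l + 2)\<^sup>2 * L * (4 * real l) ^ 12" "\<rho> \<le> 1 / 2"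
  shows "(\<Sum>S\<in>subsets_upto (edges_on V) l. L ^ card S * (\<kappa> S)\<^sup>2) \<le> 8 * \<delta>\<^sup>2 * \<rho>"
proof -
  let ?cores = "\<lambda>q. {S. S \<in> rooted_cores V roots (fst q) (snd q) \<and> card S \<le> l}"
  have finite_cores: "finite (?cores q)" for q
    using finite_edges_on[OF finite_vertices]
    by (auto simp: rooted_cores_def intro: finite_subset[of _ "Pow (edges_on V)"])
  have "(\<Sum>S\<in>subsets_upto (edges_on V) l. L ^ card S * (\<kappa> S)\<^sup>2)
      \<le> (\<Sum>q\<in>{..l} \<times> {1..l}. \<Sum>S\<in>?cores q. L ^ card S * (\<kappa> S)\<^sup>2)"
  proof (rule sum_le_sum_cover)
    fix S assume S: "S \<in> subsets_upto (edges_on V) l" and "L ^ card S * (\<kappa> S)\<^sup>2 \<noteq> 0"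
    then have "\<kappa> S \<noteq> 0" by auto
    with S obtain p j where "S \<in> rooted_cores V roots p j" "p \<le> l" "1 \<le> j" "j \<le> l"
      by (rule cumulant_nonzero_rooted_cores)
    with S show "\<exists>q\<in>{..l} \<times> {1..l}. S \<in> ?cores q"
      by (intro bexI[of _ "(p, j)"]) (auto simp: subsets_upto_def)
  qed (use weight(1) finite_cores finite_subsets_upto finite_edges_on[OF finite_vertices] in auto)
  also have "\<dots> \<le> (\<Sum>q\<in>{..l} \<times> {1..l}. 2 * \<delta>\<^sup>2 * ((1 / 2) ^ fst q * \<rho> ^ snd q))"
    by (intro sum_mono sum_cumulant_sq_shape_le weight ratio(1))
  also have "\<dots> = 2 * \<delta>\<^sup>2 * (\<Sum>(p, j)\<in>{..l} \<times> {1..l}. (1 / 2) ^ p * \<rho> ^ j)"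
    by (simp only: sum_distrib_left case_prod_unfold)
  also have "\<dots> \<le> 2 * \<delta>\<^sup>2 * (4 * \<rho>)"
    using weight(1) ratio by (intro mult_left_mono sum_geometric_mult_le) auto
  finally show ?thesis by simp
qed

end

section \<open>The stochastic block model\<close>

definition centred_agree :: "'a set \<Rightarrow> 'v \<times> 'v \<Rightarrow> ('v \<Rightarrow> 'a) \<Rightarrow> real" where
  "centred_agree K e x = of_bool (x (fst e) = x (snd e)) - 1 / real (card K)"

lemma mean_of_bool_eq: "finite A \<Longrightarrow> a \<in> A \<Longrightarrow> mean A (\<lambda>b. of_bool (b = a)) = 1 / real (card A)"
  by (simp add: mean_def)

lemma centred_agree_upd:
  assumes "ends e = {w, z}" "w \<noteq> z"
  shows "centred_agree K e (x(w := b)) = of_bool (b = x z) - 1 / real (card K)"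
  using assms by (auto simp: centred_agree_def ends_def doubleton_eq_iff)

lemma centred_edge_signal_centred_agree:
  assumes "finite V" "finite K" "K \<noteq> {}"
  shows "centred_edge_signal V K (centred_agree K) (2 / real (card K))"
proof
  have card_ge_1: "1 \<le> real (card K)" using assms(2,3) by (simp add: Suc_le_eq card_gt_0_iff)
  show "depends_on (ends e) (centred_agree K e)" for e :: "'a \<times> 'a"
    by (simp add: depends_on_def ends_def centred_agree_def)
  show "\<bar>centred_agree K e x\<bar> \<le> 1" for e :: "'a \<times> 'a" and x
    using card_ge_1 by (simp add: centred_agree_def field_simps)
  fix e w and x :: "'a \<Rightarrow> 'b" assume edge: "e \<in> edges_on V" "w \<in> ends e"
    and labelling: "x \<in> PiE V (\<lambda>_. K)"
  obtain z where ends: "ends e = {w, z}" "w \<noteq> z" "z \<in> V" using edge by (rule ends_edges_onE)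
  have label: "x z \<in> K" using labelling ends(3) by auto
  show "resample K w (centred_agree K e) x = 0"
    unfolding resample_def centred_agree_upd[OF ends(1,2)]
    by (simp add: mean_diff mean_const mean_of_bool_eq assms(2,3) label)
  have "resample K w (\<lambda>x. \<bar>centred_agree K e x\<bar>) x
      \<le> mean K (\<lambda>b. of_bool (b = x z) + 1 / real (card K))"
    unfolding resample_def centred_agree_upd[OF ends(1,2)]
    by (intro mean_mono order_trans[OF abs_triangle_ineq4]) simp
  also have "\<dots> = 2 / real (card K)"
    by (simp add: mean_add mean_const mean_of_bool_eq assms(2,3) label)
  finally show "resample K w (\<lambda>x. \<bar>centred_agree K e x\<bar>) x \<le> 2 / real (card K)" .
qed (use assms in auto)

lemma mean_centred_agree_sq:
  assumes "finite V" "finite K" "K \<noteq> {}" "e \<in> edges_on V"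
  shows "mean (PiE V (\<lambda>_. K)) (\<lambda>x. (centred_agree K e x)\<^sup>2)
      = (1 - 1 / real (card K)) / real (card K)"
proof -
  let ?a = "1 / real (card K)"
  have "fst e \<in> ends e" by (simp add: ends_def)
  with assms(4) obtain z where ends: "ends e = {fst e, z}" "fst e \<noteq> z" "fst e \<in> V" "z \<in> V"
    by (rule ends_edges_onE)
  have square: "(centred_agree K e (x(fst e := b)))\<^sup>2 = (1 - 2 * ?a) * of_bool (b = x z) + ?a\<^sup>2"
    for x b
    unfolding centred_agree_upd[OF ends(1,2)] by (simp add: power2_eq_square algebra_simps)
  have "mean (PiE V (\<lambda>_. K)) (\<lambda>x. (centred_agree K e x)\<^sup>2)
      = mean (PiE V (\<lambda>_. K)) (resample K (fst e) (\<lambda>x. (centred_agree K e x)\<^sup>2))"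
    using assms(1) ends(3) assms(2,3) by (rule mean_resample[symmetric])
  also have "\<dots> = mean (PiE V (\<lambda>_. K)) (\<lambda>_. (1 - 2 * ?a) * ?a + ?a\<^sup>2)"
  proof (rule mean_cong)
    fix x assume "x \<in> PiE V (\<lambda>_. K)"
    then have "x z \<in> K" using ends(4) by auto
    then show "resample K (fst e) (\<lambda>x. (centred_agree K e x)\<^sup>2) x = (1 - 2 * ?a) * ?a + ?a\<^sup>2"
      by (simp only: resample_def square mean_add mean_cmult mean_const[OF assms(2,3)]
          mean_of_bool_eq[OF assms(2)])
  qed
  also have "\<dots> = (1 - 2 * ?a) * ?a + ?a\<^sup>2"
    using assms(1-3) by (intro mean_const finite_PiE) (auto simp: PiE_eq_empty_iff)
  also have "\<dots> = (1 - ?a) * ?a"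
    by (simp add: power2_eq_square algebra_simps)
  finally show ?thesis by simp
qed

lemma pairs_eq_edges_on: "pairs n = edges_on {..<n}"
  by (auto simp: pairs_def edges_on_def)

lemma ssbm_theta_eq:
  assumes "0 < k"
  shows "ssbm_theta q \<epsilon> k x i j = q + q * \<epsilon> * centred_agree {..<k} (i, j) x"
  using assms by (auto simp: ssbm_theta_def centred_agree_def of_nat_diff field_simps)

lemma centred_agree_edge: "centred_agree K (edge i j) x = centred_agree K (i, j) x"
  by (auto simp: centred_agree_def edge_def min_def max_def)

locale ssbm =
  fixes n k :: nat and q \<epsilon> :: real
  assumes two_le_k: "2 \<le> k" and density: "0 < q" "q \<le> 1 / 2"
    and signal_strength: "0 < \<epsilon>" "\<epsilon> \<le> 1 / 2"

sublocale ssbm \<subseteq> centred_edge_signal "{..<n}" "{..<k}" "centred_agree {..<k}" "2 / real k"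
  using centred_edge_signal_centred_agree[of "{..<n}" "{..<k}"] two_le_k
  by (simp add: lessThan_empty_iff)

sublocale ssbm \<subseteq> latent_bernoulli "PiE {..<n} (\<lambda>_. {..<k})" "pairs n"
  "centred_agree {..<k}" q "q * \<epsilon>" "q / 8"
proof
  show "finite (pairs n)" by (simp add: pairs_eq_edges_on finite_edges_on)
  show "q / 8 \<le> (q + q * \<epsilon> * centred_agree {..<k} e x)
      * (1 - (q + q * \<epsilon> * centred_agree {..<k} e x))" for e :: "nat \<times> nat" and x
  proof -
    let ?t = "q + q * \<epsilon> * centred_agree {..<k} e x"
    have "\<bar>\<epsilon> * centred_agree {..<k} e x\<bar> \<le> 1 / 2 * 1"
      unfolding abs_mult using signal_strength abs_signal_le[of e x] by (intro mult_mono) simp_all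
    then have "q * \<bar>\<epsilon> * centred_agree {..<k} e x\<bar> \<le> q * (1 / 2)"
      using density by (intro mult_left_mono) auto
    then have "\<bar>q * \<epsilon> * centred_agree {..<k} e x\<bar> \<le> q / 2"
      using density by (simp add: abs_mult mult.assoc)
    then have "q / 2 \<le> ?t" "1 / 4 \<le> 1 - ?t" using density by linarith+
    then have "q / 2 * (1 / 4) \<le> ?t * (1 - ?t)"
      using density by (intro mult_mono) auto
    then show ?thesis by simp
  qed
qed (use density finite_labellings labellings_nonempty in auto)

context ssbm
begin

lemma ssbm_risk_eq:
  "ssbm_risk n q \<epsilon> k f
    = (\<Sum>i<n. \<Sum>j<n. joint_mean (\<lambda>x E. (f (adj E) i j - ssbm_theta q \<epsilon> k x i j)\<^sup>2))"
proof -
  have "graph_prob n q \<epsilon> k x = bernoulli_weight (pairs n) (prob x)" for x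
    using two_le_k
    by (intro ext)
      (simp add: graph_prob_def bernoulli_weight_def prob_def ssbm_theta_eq cong: if_cong)
  then have "ssbm_risk n q \<epsilon> k f
      = joint_mean (\<lambda>x E. frob_sq n (\<lambda>i j. f (adj E) i j - ssbm_theta q \<epsilon> k x i j))"
    by (simp add: ssbm_risk_def joint_mean_def bernoulli_mean_def mean_def card_PiE
        sum_divide_distrib)
  then show ?thesis
    by (simp add: frob_sq_def joint_mean_sum)
qed

lemma entry_mse_ge:
  assumes low_degree: "F \<in> low_degree (pairs n) l" and distinct: "i < n" "j < n" "i \<noteq> j"
    and below_threshold: "128 * real n * q * \<epsilon>\<^sup>2 \<le> (real k)\<^sup>2"
    and small_degree: "2 * (real l + 2)\<^sup>2 * (8 * q * \<epsilon>\<^sup>2) * (4 * real l) ^ 12 \<le> 1 / 64"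
  shows "(q * \<epsilon>)\<^sup>2 / (4 * real k) \<le> joint_mean (\<lambda>x E. (F E - ssbm_theta q \<epsilon> k x i j)\<^sup>2)"
proof -
  let ?M = "centred_agree {..<k}" and ?e = "edge i j"
  let ?K = "\<Sum>S\<in>subsets_upto (pairs n) l.
      ((q * \<epsilon>)\<^sup>2 / (q / 8)) ^ card S * (cumulant labellings (?M ?e) ?M S)\<^sup>2"
  have k_ge: "2 \<le> real k" using two_le_k by simp
  have edge_ij: "?e \<in> edges_on {..<n}" using distinct by (simp add: edge_in_edges_on)
  then interpret edge_cumulant "{..<n}" "{..<k}" ?M "2 / real k" ?e
    by unfold_locales
  have "(q * \<epsilon>)\<^sup>2 / (q / 8) = 8 * q * \<epsilon>\<^sup>2" using density by (simp add: power2_eq_square)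
  moreover have "4 * real n * (8 * q * \<epsilon>\<^sup>2) * (2 / real k)\<^sup>2 \<le> 1"
    using below_threshold k_ge by (simp add: power2_eq_square field_simps)
  ultimately have "?K
      \<le> 8 * (2 / real k)\<^sup>2 * (2 * (real l + 2)\<^sup>2 * (8 * q * \<epsilon>\<^sup>2) * (4 * real l) ^ 12)"
    unfolding pairs_eq_edges_on using small_degree density by (intro sum_cumulant_sq_le) auto
  also have "\<dots> \<le> 8 * (2 / real k)\<^sup>2 * (1 / 64)"
    using small_degree by (intro mult_left_mono) auto
  also have "\<dots> \<le> 1 / (4 * real k)"
    using k_ge by (simp add: power2_eq_square field_simps)
  finally have small: "?K \<le> 1 / (4 * real k)" .
  have "1 / (4 * real k) + 1 / (4 * real k) \<le> (1 - 1 / real k) / real k"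
    using k_ge by (simp add: field_simps)
  also have "\<dots> = mean labellings (\<lambda>x. (?M ?e x)\<^sup>2)"
    using mean_centred_agree_sq[OF finite_vertices finite_labels labels_nonempty edge_ij] by simp
  finally have "1 / (4 * real k) \<le> mean labellings (\<lambda>x. (?M ?e x)\<^sup>2) - ?K"
    using small by linarith
  then have "(q * \<epsilon>)\<^sup>2 * (1 / (4 * real k)) \<le> (q * \<epsilon>)\<^sup>2 * (mean labellings (\<lambda>x. (?M ?e x)\<^sup>2) - ?K)"
    by (rule mult_left_mono) simp
  also have "\<dots> \<le> joint_mean (\<lambda>x E. (F E - (q + q * \<epsilon> * ?M ?e x))\<^sup>2)"
    by (rule low_degree_mse_ge[OF low_degree])
  finally show ?thesis
    using two_le_k by (simp add: ssbm_theta_eq centred_agree_edge)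
qed

end

lemma sym_mat_adj: "sym_mat n (adj E)"
  by (auto simp: sym_mat_def adj_def)

lemma adj_eq_of_bool_edge: "E \<subseteq> pairs n \<Longrightarrow> adj E i j = of_bool (edge i j \<in> E)"
  by (auto simp: adj_def pairs_def edge_def min_def max_def)

lemma card_support_deg_monos_le:
  assumes "\<alpha> \<in> deg_monos n l"
  shows "{p. \<alpha> p \<noteq> 0} \<subseteq> {..<n} \<times> {..<n}" "card {p. \<alpha> p \<noteq> 0} \<le> l"
proof -
  show support: "{p. \<alpha> p \<noteq> 0} \<subseteq> {..<n} \<times> {..<n}" using assms by (auto simp: deg_monos_def)
  have "card {p. \<alpha> p \<noteq> 0} \<le> (\<Sum>p | \<alpha> p \<noteq> 0. \<alpha> p)"
    using sum_mono[of "{p. \<alpha> p \<noteq> 0}" "\<lambda>_. 1" \<alpha>] by (auto simp: Suc_le_eq)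
  also have "\<dots> \<le> (\<Sum>p\<in>{..<n} \<times> {..<n}. \<alpha> p)"
    using support by (intro sum_mono2) auto
  also have "\<dots> \<le> l" using assms by (simp add: deg_monos_def)
  finally show "card {p. \<alpha> p \<noteq> 0} \<le> l" .
qed

lemma monomial_eval_adj:
  assumes "\<alpha> \<in> deg_monos n l" "E \<subseteq> pairs n"
  shows "monomial_eval n \<alpha> (adj E) = of_bool ((\<lambda>p. edge (fst p) (snd p)) ` {p. \<alpha> p \<noteq> 0} \<subseteq> E)"
proof -
  have "monomial_eval n \<alpha> (adj E)
      = (\<Prod>p\<in>{..<n} \<times> {..<n}. of_bool (\<alpha> p \<noteq> 0 \<longrightarrow> edge (fst p) (snd p) \<in> E))"
    unfolding monomial_eval_def
    by (intro prod.cong refl) (auto simp: adj_eq_of_bool_edge[OF assms(2)])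
  also have "\<dots> = of_bool (\<forall>p\<in>{..<n} \<times> {..<n}. \<alpha> p \<noteq> 0 \<longrightarrow> edge (fst p) (snd p) \<in> E)"
    by (rule prod_of_bool) simp
  also have "\<dots> = of_bool ((\<lambda>p. edge (fst p) (snd p)) ` {p. \<alpha> p \<noteq> 0} \<subseteq> E)"
    using card_support_deg_monos_le(1)[OF assms(1)] by (intro arg_cong[where f = of_bool]) blast
  finally show ?thesis .
qed

lemma poly_maps_entry_low_degree:
  assumes "f \<in> poly_maps n l" "i < n" "j < n"
  shows "(\<lambda>E. f (adj E) i j) \<in> low_degree (pairs n) l"
proof -
  obtain c where entry_eq: "\<And>Y. sym_mat n Y \<Longrightarrow> f Y i j
      = (\<Sum>\<alpha>\<in>deg_monos n l. c \<alpha> * monomial_eval n \<alpha> Y)"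
    using assms unfolding poly_maps_def by blast
  have "(\<lambda>E. monomial_eval n \<alpha> (adj E)) \<in> low_degree (pairs n) l"
    if degree: "\<alpha> \<in> deg_monos n l" for \<alpha>
  proof (rule low_degree_cong[OF low_degree_monomial])
    show "finite (pairs n)" by (simp add: pairs_eq_edges_on finite_edges_on)
    have "finite {p. \<alpha> p \<noteq> 0}"
      using card_support_deg_monos_le(1)[OF degree] by (rule finite_subset) simp
    then show "card ((\<lambda>p. edge (fst p) (snd p)) ` {p. \<alpha> p \<noteq> 0}) \<le> l"
      using card_support_deg_monos_le(2)[OF degree] card_image_le order_trans by blast
  qed (rule monomial_eval_adj[OF degree, symmetric])
  then have "(\<lambda>E. \<Sum>\<alpha>\<in>deg_monos n l. c \<alpha> * monomial_eval n \<alpha> (adj E)) \<in> low_degree (pairs n) l"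
    by (rule low_degree_lincomb)
  then show ?thesis by (simp add: entry_eq sym_mat_adj)
qed

lemma (in ssbm) ssbm_risk_ge:
  assumes "f \<in> poly_maps n l" "128 * real n * q * \<epsilon>\<^sup>2 \<le> (real k)\<^sup>2"
    and "2 * (real l + 2)\<^sup>2 * (8 * q * \<epsilon>\<^sup>2) * (4 * real l) ^ 12 \<le> 1 / 64"
  shows "real n * (real n - 1) * ((q * \<epsilon>)\<^sup>2 / (4 * real k)) \<le> ssbm_risk n q \<epsilon> k f"
proof -
  let ?b = "(q * \<epsilon>)\<^sup>2 / (4 * real k)"
  have entry: "(if j = i then 0 else ?b)
      \<le> joint_mean (\<lambda>x E. (f (adj E) i j - ssbm_theta q \<epsilon> k x i j)\<^sup>2)"
    if "i < n" "j < n" for i j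
    using that entry_mse_ge[OF poly_maps_entry_low_degree _ _ _ assms(2,3)] assms(1)
    by (auto simp: joint_mean_nonneg)
  have "(\<Sum>j<n. if j = i then 0 else ?b) = (real n - 1) * ?b" if "i < n" for i
  proof -
    have "{..<n} \<inter> - {j. j = i} = {..<n} - {i}" by auto
    then show ?thesis using that by (simp add: sum.If_cases of_nat_diff)
  qed
  then have "real n * (real n - 1) * ?b = (\<Sum>i<n. \<Sum>j<n. if j = i then 0 else ?b)"
    by simp
  also have "\<dots> \<le> ssbm_risk n q \<epsilon> k f"
    unfolding ssbm_risk_eq using entry by (intro sum_mono) auto
  finally show ?thesis .
qed

lemma exists_ssbm_risk_ge:
  fixes c :: real
  assumes density: "0 < c" "c \<le> 1 / 2" and n_ge: "2 \<le> n"
    and labels: "2 \<le> k" "(real k)\<^sup>2 \<le> 32 * c * real n"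
    and degree: "(real l + 2)\<^sup>2 * (real k)\<^sup>2 * (4 * real l) ^ 12 \<le> real n / 8"
    and poly: "f \<in> poly_maps n l"
  shows "\<exists>\<epsilon>\<in>{0..1}. c / 1024 * real k * real n \<le> ssbm_risk n c \<epsilon> k f"
proof
  define \<epsilon> where "\<epsilon> = real k / sqrt (128 * c * real n)"
  have cn_pos: "0 < 128 * c * real n" using density n_ge by simp
  have eps_sq: "\<epsilon>\<^sup>2 = (real k)\<^sup>2 / (128 * c * real n)"
    using cn_pos by (simp add: \<epsilon>_def power_divide)
  have "\<epsilon>\<^sup>2 \<le> (1 / 2)\<^sup>2"
    unfolding eps_sq using labels(2) cn_pos by (simp add: power2_eq_square divide_simps)
  then have eps: "0 < \<epsilon>" "\<epsilon> \<le> 1 / 2"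
    using labels(1) cn_pos by (auto simp: \<epsilon>_def intro: power2_le_imp_le)
  then show "\<epsilon> \<in> {0..1}" by simp
  interpret ssbm n k c \<epsilon>
    by unfold_locales (use labels density eps in auto)
  have "2 * (real l + 2)\<^sup>2 * (8 * c * \<epsilon>\<^sup>2) * (4 * real l) ^ 12
      = (real l + 2)\<^sup>2 * (real k)\<^sup>2 * (4 * real l) ^ 12 / (8 * real n)"
    unfolding eps_sq using density n_ge by (simp add: field_simps)
  also have "\<dots> \<le> real n / 8 / (8 * real n)"
    using degree by (rule divide_right_mono) simp
  finally have "2 * (real l + 2)\<^sup>2 * (8 * c * \<epsilon>\<^sup>2) * (4 * real l) ^ 12 \<le> 1 / 64"
    using n_ge by simp
  moreover have "128 * real n * c * \<epsilon>\<^sup>2 \<le> (real k)\<^sup>2"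
    unfolding eps_sq using density n_ge by simp
  ultimately have "real n * (real n - 1) * ((c * \<epsilon>)\<^sup>2 / (4 * real k)) \<le> ssbm_risk n c \<epsilon> k f"
    using poly by (intro ssbm_risk_ge)
  moreover have "real n * (real n - 1) * ((c * \<epsilon>)\<^sup>2 / (4 * real k))
      = c / 512 * real k * (real n - 1)"
    unfolding power_mult_distrib eps_sq using density n_ge labels
    by (simp add: power2_eq_square field_simps)
  moreover have "c / 512 * real k * (real n / 2) \<le> c / 512 * real k * (real n - 1)"
    using density n_ge by (intro mult_left_mono) auto
  ultimately show "c / 1024 * real k * real n \<le> ssbm_risk n c \<epsilon> k f"
    by linarith
qed

lemma eventually_subpolynomial_bounds:
  fixes c :: real
  assumes "0 < c"
  shows "\<forall>\<^sub>F n in sequentially. \<forall>k l :: nat. real k \<le> real n powr 0.001 \<and> real l \<le> real n powr 0.001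
    \<longrightarrow> (real k)\<^sup>2 \<le> 32 * c * real n \<and> (real l + 2)\<^sup>2 * (real k)\<^sup>2 * (4 * real l) ^ 12 \<le> real n / 8"
proof -
  have "\<forall>\<^sub>F n in sequentially. (real n powr 0.001)\<^sup>2 \<le> 32 * c * real n"
    using assms by real_asymp
  moreover have "\<forall>\<^sub>F n in sequentially.
      (real n powr 0.001 + 2)\<^sup>2 * (real n powr 0.001)\<^sup>2 * (4 * real n powr 0.001) ^ 12 \<le> real n / 8"
    by real_asymp
  ultimately show ?thesis
  proof (eventually_elim, intro allI impI, elim conjE)
    fix n k l :: nat
    define t where "t = real n powr 0.001"
    assume "real k \<le> real n powr 0.001" "real l \<le> real n powr 0.001"
    then have le_t: "real k \<le> t" "real l \<le> t" by (simp_all add: t_def)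
    then have square_le: "(real k)\<^sup>2 \<le> t\<^sup>2" by (intro power_mono) auto
    have "(real l + 2)\<^sup>2 * (real k)\<^sup>2 * (4 * real l) ^ 12 \<le> (t + 2)\<^sup>2 * t\<^sup>2 * (4 * t) ^ 12"
      using le_t by (intro mult_mono square_le power_mono) auto
    moreover assume "(real n powr 0.001)\<^sup>2 \<le> 32 * c * real n"
      "(real n powr 0.001 + 2)\<^sup>2 * (real n powr 0.001)\<^sup>2 * (4 * real n powr 0.001) ^ 12
          \<le> real n / 8"
    ultimately show "(real k)\<^sup>2 \<le> 32 * c * real n
        \<and> (real l + 2)\<^sup>2 * (real k)\<^sup>2 * (4 * real l) ^ 12 \<le> real n / 8"
      using square_le unfolding t_def[symmetric] by linarith
  qed
qed

theorem theoremE1: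
  fixes c :: real
  assumes "0 < c" and "c \<le> 1/2"
  shows "\<exists>C>0. \<exists>N. \<forall>n\<ge>N. \<forall>k l :: nat.
           n > 0 \<and> 2 \<le> k \<and> real k \<le> real n powr 0.001 \<and> real l \<le> real n powr 0.001
           \<and> k dvd n \<longrightarrow>
           (\<forall>f\<in>poly_maps n l. \<exists>\<epsilon>\<in>{0..1}.
              ssbm_risk n ((c * real n) / real n) \<epsilon> k f \<ge> C * real k * real n)"
    (is "\<exists>C>0. \<exists>N. \<forall>n\<ge>N. ?bound C n")
proof -
  have "\<forall>\<^sub>F n in sequentially. ?bound (c / 1024) n"
    using eventually_ge_at_top[of 2] eventually_subpolynomial_bounds[OF assms(1)]
  proof (eventually_elim, intro allI impI ballI, elim conjE)
    fix n k l :: nat and f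
    assume n_ge: "2 \<le> n" and k_ge: "2 \<le> k" and poly: "f \<in> poly_maps n l"
      and le_powr: "real k \<le> real n powr 0.001" "real l \<le> real n powr 0.001"
      and bounds: "\<forall>k l. real k \<le> real n powr 0.001 \<and> real l \<le> real n powr 0.001
        \<longrightarrow> (real k)\<^sup>2 \<le> 32 * c * real n
          \<and> (real l + 2)\<^sup>2 * (real k)\<^sup>2 * (4 * real l) ^ 12 \<le> real n / 8"
    have "c * real n / real n = c" using n_ge by simp
    then show "\<exists>\<epsilon>\<in>{0..1}. c / 1024 * real k * real n \<le> ssbm_risk n (c * real n / real n) \<epsilon> k f"
      using exists_ssbm_risk_ge[OF assms n_ge k_ge _ _ poly] bounds le_powr by simp
  qed
  moreover have "0 < c / 1024" using assms(1) by simp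
  ultimately show ?thesis unfolding eventually_sequentially by blast
qed

end
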